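(* Let $\mathcal O_q$ be the algebra defined in the context. Consider the elements $\mathcal W_0$, $\mathcal W_1$, $\{\tilde{\mathcal G}_{k+1}\}_{k\in\mathbb N}$ of $\mathcal O_q$. Then $\mathcal O_q$ has a presentation by the generators $\mathcal W_0$, $\mathcal W_1$, $\{\tilde{\mathcal G}_{k+1}\}_{k\in\mathbb N}$ and the following relations: (i) $[\mathcal W_0,[\mathcal W_0,[\mathcal W_0,\mathcal W_1]_q]_{q^{-1}}]=(q^2-q^{-2})^2[\mathcal W_1,\mathcal W_0]$; (ii) $[\mathcal W_1,[\mathcal W_1,[\mathcal W_1,\mathcal W_0]_q]_{q^{-1}}]=(q^2-q^{-2})^2[\mathcal W_0,\mathcal W_1]$; (iii) $[\mathcal W_0,\tilde{\mathcal G}_1]=[\mathcal W_0,[\mathcal W_0,\mathcal W_1]_q]$; (iv) $[\tilde{\mathcal G}_1,\mathcal W_1]=[[\mathcal W_0,\mathcal W_1]_q,\mathcal W_1]$; (v) for $k\ge 1$: $[\tilde{\mathcal G}_{k+1},\mathcal W_0]=\dfrac{[\mathcal W_0,[\mathcal W_0,[\mathcal W_1,\tilde{\mathcal G}_k]_q]_q]}{(q^2-q^{-2})^2}$; (vi) for $k\ge1$: $[\mathcal W_1,\tilde{\mathcal G}_{k+1}]=\dfrac{[[[\tilde{\mathcal G}_k,\mathcal W_0]_q,\mathcal W_1]_q,\mathcal W_1]}{(q^2-q^{-2})^2}$; (vii) for $k,\ell\in\mathbb N$: $[\tilde{\mathcal G}_{k+1},\tilde{\mathcal G}_{\ell+1}]=0$.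 That is, if $\mathcal O^\vee_q$ denotes the algebra abstractly defined by generators $\mathcal W_0,\mathcal W_1,\{\tilde{\mathcal G}_{k+1}\}_{k\in\mathbb N}$ and relations (i)–(vii), then there is an algebra isomorphism $\mathcal O^\vee_q\to\mathcal O_q$ sending each of these generators to the element of $\mathcal O_q$ with the same name.
   Context: All algebras are associative and unital over a field $\mathbb F$; $q\in\mathbb F$ is nonzero and not a root of unity. For elements $X,Y$ of an algebra, $[X,Y]=XY-YX$ and $[X,Y]_q=qXY-q^{-1}YX$. Let $\rho=-(q^2-q^{-2})^2$. The algebra $\mathcal O_q$ (the alternating central extension of the $q$-Onsager algebra) is defined by generators $\mathcal W_{-k},\mathcal W_{k+1},\mathcal G_{k+1},\tilde{\mathcal G}_{k+1}$ ($k\in\mathbb N$) and the following relations for all $k,\ell\in\mathbb N$: $[\mathcal W_0,\mathcal W_{k+1}]=[\mathcal W_{-k},\mathcal W_1]=(\tilde{\mathcal G}_{k+1}-\mathcal G_{k+1})/(q+q^{-1})$; $[\mathcal W_0,\mathcal G_{k+1}]_q=[\tilde{\mathcal G}_{k+1},\mathcal W_0]_q=\rho\mathcal W_{-k-1}-\rho\mathcal W_{k+1}$; $[\mathcal G_{k+1},\mathcal W_1]_q=[\mathcal W_1,\tilde{\mathcal G}_{k+1}]_q=\rho\mathcal W_{k+2}-\rho\mathcal W_{-k}$; $[\mathcal W_{-k},\mathcal W_{-\ell}]=0$, $[\mathcal W_{k+1},\mathcal W_{\ell+1}]=0$; $[\mathcal W_{-k},\mathcal W_{\ell+1}]+[\mathcal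 W_{k+1},\mathcal W_{-\ell}]=0$; $[\mathcal W_{-k},\mathcal G_{\ell+1}]+[\mathcal G_{k+1},\mathcal W_{-\ell}]=0$; $[\mathcal W_{-k},\tilde{\mathcal G}_{\ell+1}]+[\tilde{\mathcal G}_{k+1},\mathcal W_{-\ell}]=0$; $[\mathcal W_{k+1},\mathcal G_{\ell+1}]+[\mathcal G_{k+1},\mathcal W_{\ell+1}]=0$; $[\mathcal W_{k+1},\tilde{\mathcal G}_{\ell+1}]+[\tilde{\mathcal G}_{k+1},\mathcal W_{\ell+1}]=0$; $[\mathcal G_{k+1},\mathcal G_{\ell+1}]=0$, $[\tilde{\mathcal G}_{k+1},\tilde{\mathcal G}_{\ell+1}]=0$; $[\tilde{\mathcal G}_{k+1},\mathcal G_{\ell+1}]+[\mathcal G_{k+1},\tilde{\mathcal G}_{\ell+1}]=0$. *)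

theory Defs
  imports "HOL-Algebra.QuotRing"
begin

text \<open>Noncommutative polynomials with generators of type 'x and coefficients in the
field 'f: finitely supported functions from words (lists of generators) to 'f.
Multiplication is concatenation-convolution.\<close>

definition fa_mult :: "('x list \<Rightarrow> 'f::field) \<Rightarrow> ('x list \<Rightarrow> 'f) \<Rightarrow> 'x list \<Rightarrow> 'f" where
  "fa_mult p r = (\<lambda>w. \<Sum>i\<le>length w. p (take i w) * r (drop i w))"

definition fa_scal :: "'f::field \<Rightarrow> 'x list \<Rightarrow> 'f" where
  "fa_scal c = (\<lambda>w. if w = [] then c else 0)"

definition fa_var :: "'x \<Rightarrow> 'x list \<Rightarrow> 'f::field" where
  "fa_var x = (\<lambda>w. if w = [x] then 1 else 0)"

definition free_alg :: "('x list \<Rightarrow> 'f::field) ring" where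
  "free_alg = \<lparr> carrier = {p. finite {w. p w \<noteq> 0}},
                mult = fa_mult,
                one = fa_scal 1,
                zero = (\<lambda>w. 0),
                add = (\<lambda>p r w. p w + r w) \<rparr>"

definition fa_add :: "('x list \<Rightarrow> 'f::field) \<Rightarrow> ('x list \<Rightarrow> 'f) \<Rightarrow> 'x list \<Rightarrow> 'f" where
  "fa_add p r = (\<lambda>w. p w + r w)"

definition fa_sub :: "('x list \<Rightarrow> 'f::field) \<Rightarrow> ('x list \<Rightarrow> 'f) \<Rightarrow> 'x list \<Rightarrow> 'f" where
  "fa_sub p r = (\<lambda>w. p w - r w)"

definition fa_smult :: "'f::field \<Rightarrow> ('x list \<Rightarrow> 'f) \<Rightarrow> 'x list \<Rightarrow> 'f" where
  "fa_smult c p = (\<lambda>w. c * p w)"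

definition fa_comm :: "('x list \<Rightarrow> 'f::field) \<Rightarrow> ('x list \<Rightarrow> 'f) \<Rightarrow> 'x list \<Rightarrow> 'f" where
  "fa_comm X Y = fa_sub (fa_mult X Y) (fa_mult Y X)"

definition fa_qcomm :: "'f::field \<Rightarrow> ('x list \<Rightarrow> 'f) \<Rightarrow> ('x list \<Rightarrow> 'f) \<Rightarrow> 'x list \<Rightarrow> 'f" where
  "fa_qcomm q X Y = fa_sub (fa_smult q (fa_mult X Y)) (fa_smult (inverse q) (fa_mult Y X))"

text \<open>Generators: OWn k = W_{-k}, OWp k = W_{k+1}, OG k = G_{k+1}, OGt k = tilde G_{k+1}.\<close>

datatype ogen = OWn nat | OWp nat | OG nat | OGt nat

definition rho :: "'f::field \<Rightarrow> 'f" where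
  "rho q = - ((q^2 - (inverse q) ^ 2)^2)"

text \<open>Each defining relation LHS = RHS is encoded by the element LHS - RHS.\<close>

definition Oq_rels :: "'f::field \<Rightarrow> (ogen list \<Rightarrow> 'f) set" where
  "Oq_rels q = (\<Union>k. \<Union>l. {
     \<comment> \<open>[W_0, W_{k+1}] = (tG_{k+1} - G_{k+1})/(q+q^{-1})\<close>
     fa_sub (fa_comm (fa_var (OWn 0)) (fa_var (OWp k)))
            (fa_smult (inverse (q + inverse q)) (fa_sub (fa_var (OGt k)) (fa_var (OG k)))),
     \<comment> \<open>[W_{-k}, W_1] = (tG_{k+1} - G_{k+1})/(q+q^{-1})\<close>
     fa_sub (fa_comm (fa_var (OWn k)) (fa_var (OWp 0)))
            (fa_smult (inverse (q + inverse q)) (fa_sub (fa_var (OGt k)) (fa_var (OG k)))),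
     \<comment> \<open>[W_0, G_{k+1}]_q = rho W_{-k-1} - rho W_{k+1}\<close>
     fa_sub (fa_qcomm q (fa_var (OWn 0)) (fa_var (OG k)))
            (fa_sub (fa_smult (rho q) (fa_var (OWn (Suc k)))) (fa_smult (rho q) (fa_var (OWp k)))),
     \<comment> \<open>[tG_{k+1}, W_0]_q = rho W_{-k-1} - rho W_{k+1}\<close>
     fa_sub (fa_qcomm q (fa_var (OGt k)) (fa_var (OWn 0)))
            (fa_sub (fa_smult (rho q) (fa_var (OWn (Suc k)))) (fa_smult (rho q) (fa_var (OWp k)))),
     \<comment> \<open>[G_{k+1}, W_1]_q = rho W_{k+2} - rho W_{-k}\<close>
     fa_sub (fa_qcomm q (fa_var (OG k)) (fa_var (OWp 0)))
            (fa_sub (fa_smult (rho q) (fa_var (OWp (Suc k)))) (fa_smult (rho q) (fa_var (OWn k)))),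
     \<comment> \<open>[W_1, tG_{k+1}]_q = rho W_{k+2} - rho W_{-k}\<close>
     fa_sub (fa_qcomm q (fa_var (OWp 0)) (fa_var (OGt k)))
            (fa_sub (fa_smult (rho q) (fa_var (OWp (Suc k)))) (fa_smult (rho q) (fa_var (OWn k)))),
     fa_comm (fa_var (OWn k)) (fa_var (OWn l)),
     fa_comm (fa_var (OWp k)) (fa_var (OWp l)),
     fa_add (fa_comm (fa_var (OWn k)) (fa_var (OWp l))) (fa_comm (fa_var (OWp k)) (fa_var (OWn l))),
     fa_add (fa_comm (fa_var (OWn k)) (fa_var (OG l))) (fa_comm (fa_var (OG k)) (fa_var (OWn l))),
     fa_add (fa_comm (fa_var (OWn k)) (fa_var (OGt l))) (fa_comm (fa_var (OGt k)) (fa_var (OWn l))),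
     fa_add (fa_comm (fa_var (OWp k)) (fa_var (OG l))) (fa_comm (fa_var (OG k)) (fa_var (OWp l))),
     fa_add (fa_comm (fa_var (OWp k)) (fa_var (OGt l))) (fa_comm (fa_var (OGt k)) (fa_var (OWp l))),
     fa_comm (fa_var (OG k)) (fa_var (OG l)),
     fa_comm (fa_var (OGt k)) (fa_var (OGt l)),
     fa_add (fa_comm (fa_var (OGt k)) (fa_var (OG l))) (fa_comm (fa_var (OG k)) (fa_var (OGt l)))
   })"

definition Oq_ideal :: "'f::field \<Rightarrow> (ogen list \<Rightarrow> 'f) set" where
  "Oq_ideal q = genideal free_alg (Oq_rels q)"

definition Oq :: "'f::field \<Rightarrow> (ogen list \<Rightarrow> 'f) set ring" where
  "Oq q = free_alg Quot Oq_ideal q"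

text \<open>Generators: VW0 = W_0, VW1 = W_1, VGt k = tilde G_{k+1}.\<close>

datatype vgen = VW0 | VW1 | VGt nat

definition Oqv_rels :: "'f::field \<Rightarrow> (vgen list \<Rightarrow> 'f) set" where
  "Oqv_rels q = (let W0 = fa_var VW0; W1 = fa_var VW1; c = (q^2 - (inverse q) ^ 2)^2 in
   { \<comment> \<open>(i)\<close>
     fa_sub (fa_comm W0 (fa_qcomm (inverse q) W0 (fa_qcomm q W0 W1))) (fa_smult c (fa_comm W1 W0)),
     \<comment> \<open>(ii)\<close>
     fa_sub (fa_comm W1 (fa_qcomm (inverse q) W1 (fa_qcomm q W1 W0))) (fa_smult c (fa_comm W0 W1)),
     \<comment> \<open>(iii)\<close>
     fa_sub (fa_comm W0 (fa_var (VGt 0))) (fa_comm W0 (fa_qcomm q W0 W1)),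
     \<comment> \<open>(iv)\<close>
     fa_sub (fa_comm (fa_var (VGt 0)) W1) (fa_comm (fa_qcomm q W0 W1) W1) }
   \<union> (\<Union>k. {
     \<comment> \<open>(v), with k+1 in place of k (k \<ge> 1)\<close>
     fa_sub (fa_comm (fa_var (VGt (Suc k))) W0)
            (fa_smult (inverse c) (fa_comm W0 (fa_qcomm q W0 (fa_qcomm q W1 (fa_var (VGt k)))))),
     \<comment> \<open>(vi), with k+1 in place of k (k \<ge> 1)\<close>
     fa_sub (fa_comm W1 (fa_var (VGt (Suc k))))
            (fa_smult (inverse c) (fa_comm (fa_qcomm q (fa_qcomm q (fa_var (VGt k)) W0) W1) W1)) })
   \<union> (\<Union>k. \<Union>l. { \<comment> \<open>(vii)\<close> fa_comm (fa_var (VGt k)) (fa_var (VGt l)) }))"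

definition Oqv_ideal :: "'f::field \<Rightarrow> (vgen list \<Rightarrow> 'f) set" where
  "Oqv_ideal q = genideal free_alg (Oqv_rels q)"

definition Oqv :: "'f::field \<Rightarrow> (vgen list \<Rightarrow> 'f) set ring" where
  "Oqv q = free_alg Quot Oqv_ideal q"

end

theory Submission
  imports Defs
begin

text \<open>
  That \<open>O\<^sub>q\<close> satisfies the compact relations is a short computation; the content is the
  converse. Inside the compactly presented algebra, define \<open>W\<^bsub>-k\<^esub>\<close>, \<open>W\<^bsub>k+1\<^esub>\<close> and \<open>G\<^bsub>k+1\<^esub>\<close>
  recursively by the relations they have to satisfy, give \<open>W\<^bsub>-k\<^esub>\<close>, \<open>W\<^bsub>k+1\<^esub>\<close> the degree \<open>2k+1\<close> and
  \<open>G\<^bsub>k+1\<^esub>\<close>, \<open>tG\<^bsub>k+1\<^esub>\<close> the degree \<open>2k+2\<close>, and prove the relations by induction on the degree.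
  Put \<open>D\<^sub>k = [W\<^sub>0, W\<^bsub>k+1\<^esub>]\<close> and \<open>\<delta>\<^sub>k = [D\<^sub>k, D\<^bsub>n-k\<^esub>]\<close>. In even degree the defects
  \<open>R\<^sub>k = \<rho>([W\<^bsub>-k\<^esub>, W\<^bsub>n+2-k\<^esub>] + [W\<^bsub>k+1\<^esub>, W\<^bsub>k-n-1\<^esub>])\<close> satisfy both \<open>R\<^sub>k = \<delta>\<^bsub>k-1\<^esub> + \<delta>\<^sub>k\<close> and
  \<open>R\<^sub>k + R\<^bsub>k+1\<^esub> = (q + 1/q)\<^sup>2 \<delta>\<^sub>k\<close>. Hence \<open>\<delta>\<^bsub>k+1\<^esub> - (q\<^sup>2 + 1/q\<^sup>2) \<delta>\<^sub>k + \<delta>\<^bsub>k-1\<^esub> = 0\<close> with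
  \<open>\<delta>\<^bsub>-1\<^esub> = 0 = \<delta>\<^bsub>n+1\<^esub>\<close>, and since \<open>q\<close> is not a root of unity all defects vanish. In odd degree one
  uses that \<open>tG\<^sub>1 - [W\<^sub>0, W\<^sub>1]\<^sub>q\<close> commutes with everything constructed so far.
\<close>

section \<open>Commutators and \<open>q\<close>-commutators\<close>

text \<open>
  The multiplication is a parameter rather than a type class operation, so that every lemma can be
  reused with the factors swapped: the presentations are stable under the anti-automorphism that
  exchanges \<open>W\<^bsub>-k\<^esub>\<close> and \<open>W\<^bsub>k+1\<^esub>\<close>.
\<close>

locale nalg =
  fixes sc :: "'f::field \<Rightarrow> 'a::ab_group_add \<Rightarrow> 'a" and mul :: "'a \<Rightarrow> 'a \<Rightarrow> 'a" (infixl "\<cdot>" 70)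
  assumes mul_assoc: "(u \<cdot> v) \<cdot> w = u \<cdot> (v \<cdot> w)"
    and mul_add_left: "(u + v) \<cdot> w = u \<cdot> w + v \<cdot> w"
    and mul_add_right: "u \<cdot> (v + w) = u \<cdot> v + u \<cdot> w"
    and sc_mul_left: "sc c u \<cdot> v = sc c (u \<cdot> v)"
    and sc_mul_right: "u \<cdot> sc c v = sc c (u \<cdot> v)"
    and sc_add_right: "sc c (u + v) = sc c u + sc c v"
    and sc_add_left: "sc (c + d) u = sc c u + sc d u"
    and sc_sc: "sc c (sc d u) = sc (c * d) u"
    and sc_one: "sc 1 u = u"
begin

lemma mul_zero_left [simp]: "0 \<cdot> u = 0"
  using mul_add_left[of 0 0 u] by simp

lemma mul_zero_right [simp]: "u \<cdot> 0 = 0"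
  using mul_add_right[of u 0 0] by simp

lemma sc_zero_left [simp]: "sc 0 u = 0"
  using sc_add_left[of 0 0 u] by simp

lemma sc_zero_right [simp]: "sc c 0 = 0"
  using sc_add_right[of c 0 0] by simp

lemma mul_minus_left: "(- u) \<cdot> v = - (u \<cdot> v)"
  using mul_add_left[of "- u" u v] by (simp add: eq_neg_iff_add_eq_0)

lemma mul_minus_right: "u \<cdot> (- v) = - (u \<cdot> v)"
  using mul_add_right[of u "- v" v] by (simp add: eq_neg_iff_add_eq_0)

lemma sc_minus_left: "sc (- c) u = - sc c u"
  using sc_add_left[of "- c" c u] by (simp add: eq_neg_iff_add_eq_0)

lemma sc_minus_right: "sc c (- u) = - sc c u"
  using sc_add_right[of c "- u" u] by (simp add: eq_neg_iff_add_eq_0)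

lemma mul_diff_left: "(u - v) \<cdot> w = u \<cdot> w - v \<cdot> w"
  using mul_add_left[of u "- v" w] by (simp add: mul_minus_left)

lemma mul_diff_right: "u \<cdot> (v - w) = u \<cdot> v - u \<cdot> w"
  using mul_add_right[of u v "- w"] by (simp add: mul_minus_right)

lemma sc_diff_left: "sc (c - d) u = sc c u - sc d u"
  using sc_add_left[of c "- d" u] by (simp add: sc_minus_left)

lemma sc_diff_right: "sc c (u - v) = sc c u - sc c v"
  using sc_add_right[of c u "- v"] by (simp add: sc_minus_right)

lemma sc_eq_0_iff: "c \<noteq> 0 \<Longrightarrow> sc c u = 0 \<longleftrightarrow> u = 0"
  by (metis sc_sc sc_one sc_zero_right left_inverse)

lemma sc_cancel: "c \<noteq> 0 \<Longrightarrow> sc c u = sc c v \<longleftrightarrow> u = v"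
  by (metis sc_sc sc_one left_inverse)

lemmas expand_simps = mul_assoc mul_add_left mul_add_right mul_diff_left mul_diff_right
  mul_minus_left mul_minus_right sc_mul_left sc_mul_right sc_add_left sc_add_right
  sc_diff_left sc_diff_right sc_minus_left sc_minus_right sc_sc sc_one

lemma sc_two: "sc 2 u = u + u"
  using sc_add_left[of 1 1 u] by (simp add: sc_one)

lemma sc_sum: "sc (sum f A) u = (\<Sum>i\<in>A. sc (f i) u)"
  by (induction A rule: infinite_finite_induct) (simp_all add: sc_add_left)

lemma mul_sum_left: "sum f A \<cdot> u = (\<Sum>i\<in>A. f i \<cdot> u)"
  by (induction A rule: infinite_finite_induct) (simp_all add: mul_add_left)

lemma mul_sum_right: "u \<cdot> sum f A = (\<Sum>i\<in>A. u \<cdot> f i)"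
  by (induction A rule: infinite_finite_induct) (simp_all add: mul_add_right)

lemma scaled_eq_iff: "c \<noteq> 0 \<Longrightarrow> u = sc (inverse c) v \<longleftrightarrow> sc c u = v"
  by (metis sc_sc sc_one left_inverse right_inverse)

definition cm :: "'a \<Rightarrow> 'a \<Rightarrow> 'a" where
  "cm u v = u \<cdot> v - v \<cdot> u"

lemma opposite: "nalg sc (\<lambda>u v. v \<cdot> u)"
  by unfold_locales (simp_all add: expand_simps)

end

text \<open>\<open>p\<close> is the inverse of \<open>q\<close>. As a separate symbol it lets mixed
  products of \<open>q\<close> and \<open>p\<close> be normalised by
  \<open>pq_simps\<close>.\<close>

locale qalg = nalg sc mul
  for sc :: "'f::field \<Rightarrow> 'a::ab_group_add \<Rightarrow> 'a" and mul :: "'a \<Rightarrow> 'a \<Rightarrow> 'a" (infixl "\<cdot>" 70) +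
  fixes q p :: 'f
  assumes qp: "q * p = 1"
begin

lemma pq_simps: "q * p = 1" "p * q = 1" "q * (p * c) = c" "p * (q * c) = c"
  using qp by (simp_all add: mult.commute[of p q] flip: mult.assoc)

definition qc :: "'a \<Rightarrow> 'a \<Rightarrow> 'a" where
  "qc u v = sc q (u \<cdot> v) - sc p (v \<cdot> u)"

lemma opposite_qalg: "qalg sc (\<lambda>u v. v \<cdot> u) q p"
  by (simp add: qalg_def qalg_axioms_def opposite qp)

lemma cm_linear:
  "cm (u + v) w = cm u w + cm v w" "cm w (u + v) = cm w u + cm w v"
  "cm (u - v) w = cm u w - cm v w" "cm w (u - v) = cm w u - cm w v"
  "cm (- u) w = - cm u w" "cm w (- u) = - cm w u"
  "cm (sc c u) w = sc c (cm u w)" "cm w (sc c u) = sc c (cm w u)"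
  "cm 0 w = 0" "cm w 0 = 0"
  by (simp_all add: cm_def expand_simps)

lemma qc_linear:
  "qc (u + v) w = qc u w + qc v w" "qc w (u + v) = qc w u + qc w v"
  "qc (u - v) w = qc u w - qc v w" "qc w (u - v) = qc w u - qc w v"
  "qc (- u) w = - qc u w" "qc w (- u) = - qc w u"
  "qc (sc c u) w = sc c (qc u w)" "qc w (sc c u) = sc c (qc w u)"
  "qc 0 w = 0" "qc w 0 = 0"
  by (simp_all add: qc_def expand_simps mult.commute)

lemma qc_scale_diff: "sc c (sc c (qc u v - qc u' v')) = qc (sc c u) (sc c v) - qc (sc c u') (sc c v')"
  by (simp only: qc_linear sc_diff_right)

lemma cm_self [simp]: "cm u u = 0"
  by (simp add: cm_def)

lemma cm_swap: "cm u v = - cm v u"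
  by (simp add: cm_def)

lemma cm_eq_0_swap: "cm u v = 0 \<longleftrightarrow> cm v u = 0"
  by (auto simp: cm_def)

lemma cm_qc_left: "cm (qc u v) w = qc (cm u w) v + qc u (cm v w)"
  by (simp add: cm_def qc_def expand_simps)

lemma cm_qc_right: "cm w (qc u v) = qc (cm w u) v + qc u (cm w v)"
  by (simp add: cm_def qc_def expand_simps)

lemma jacobi: "cm u (cm v w) = cm (cm u v) w + cm v (cm u w)"
  by (simp add: cm_def expand_simps)

lemma qc_antisym: "qc u v - qc v u = sc (q + p) (cm u v)"
  by (simp add: cm_def qc_def expand_simps algebra_simps)

text \<open>Two instances of \<open>qc_antisym\<close>. It recovers a plain commutator once
  q-commutators are known for both orders of the factors.\<close>

lemma qc_sum_cm: "qc b a' - qc b' a - (qc a' b - qc a b') = sc (q + p) (cm a b' - cm a' b)"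
  by (simp add: cm_def qc_def expand_simps algebra_simps)

text \<open>Antisymmetrising in the commuting \<open>g\<close> and \<open>h\<close> cancels every
  word in which they are adjacent; the remaining words match. This reduces q-commutators of the
  differences \<open>x (Suc k) - y k\<close> and \<open>y (Suc k) - x k\<close> to commutators of
  known elements.\<close>

lemma qc_exchange:
  assumes "cm g h = 0"
  shows "qc (qc b g) (qc h a) - qc (qc b h) (qc g a) = cm g (cm (qc h a) b) - cm h (cm (qc g a) b)"
proof -
  have gh: "g \<cdot> h = h \<cdot> g"
    using assms by (simp add: cm_def)
  have gh': "g \<cdot> (h \<cdot> w) = h \<cdot> (g \<cdot> w)" for w
    by (metis gh mul_assoc)
  show ?thesis
    by (simp add: cm_def qc_def expand_simps gh gh' algebra_simps pq_simps)
qed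

lemma qc_exchange_opposite:
  assumes "cm g h = 0"
  shows "qc (qc a h) (qc g b) - qc (qc a g) (qc h b) = cm (cm b (qc a h)) g - cm (cm b (qc a g)) h"
proof -
  interpret op: qalg sc "\<lambda>u v. v \<cdot> u" q p
    by (rule opposite_qalg)
  have cm: "op.cm u v = cm v u" and qc: "op.qc u v = qc v u" for u v
    by (simp_all add: cm_def qc_def op.cm_def op.qc_def)
  show ?thesis
    using op.qc_exchange[of g h b a] assms by (simp add: cm qc cm_eq_0_swap)
qed

text \<open>Meant for \<open>a = x 0\<close>, where the q-commutators are multiples of
  \<open>x (Suc k) - y k\<close>: their commutator is reduced to brackets with \<open>a\<close>,
  which are already known.\<close>

lemma cm_of_qc:
  assumes "cm g h = 0"
  shows "sc (q + p) (cm (qc g a) (qc h a))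
    + (sc (q * q) (g \<cdot> cm (qc h a) a) - sc (p * p) (cm (qc h a) a \<cdot> g))
    - (sc (q * q) (h \<cdot> cm (qc g a) a) - sc (p * p) (cm (qc g a) a \<cdot> h)) = 0"
proof -
  have gh: "g \<cdot> h = h \<cdot> g"
    using assms by (simp add: cm_def)
  have gh': "g \<cdot> (h \<cdot> w) = h \<cdot> (g \<cdot> w)" for w
    by (metis gh mul_assoc)
  show ?thesis
    by (simp add: cm_def qc_def expand_simps gh gh' algebra_simps pq_simps)
qed

text \<open>The bracket with coefficients \<open>q * q\<close> and \<open>p * p\<close> is
  \<open>q + p\<close> times the q-commutator minus the commutator, and the commutators agree by
  assumption.\<close>

lemma qc_skew_expand:
  assumes "cm g h = cm g' h'"
  shows "sc (q * q) (g \<cdot> h) - sc (p * p) (h \<cdot> g) - (sc (q * q) (g' \<cdot> h') - sc (p * p) (h' \<cdot> g'))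
    = sc (q + p) (qc g h - qc g' h')"
proof -
  have gh: "h \<cdot> g = g \<cdot> h - g' \<cdot> h' + h' \<cdot> g'"
    using assms by (simp add: cm_def algebra_simps)
  show ?thesis
    by (simp add: qc_def expand_simps gh algebra_simps pq_simps)
qed

lemma qc_qc_commute:
  assumes "cm g h = 0"
  shows "qc g (qc h a) = qc h (qc g a)"
proof -
  have gh: "g \<cdot> h = h \<cdot> g"
    using assms by (simp add: cm_def)
  have gh': "g \<cdot> (h \<cdot> w) = h \<cdot> (g \<cdot> w)" for w
    by (metis gh mul_assoc)
  show ?thesis
    by (simp add: qc_def expand_simps gh gh' algebra_simps pq_simps)
qed

lemma cm_qc_sym:
  assumes "cm g h = 0"
  shows "cm (qc b h) g + qc g (cm b h) = cm (qc b g) h + qc h (cm b g)"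
proof -
  have gh: "g \<cdot> h = h \<cdot> g"
    using assms by (simp add: cm_def)
  have gh': "g \<cdot> (h \<cdot> w) = h \<cdot> (g \<cdot> w)" for w
    by (metis gh mul_assoc)
  show ?thesis
    by (simp add: cm_def qc_def expand_simps gh gh' algebra_simps pq_simps)
qed

text \<open>A cyclic identity: \<open>g\<close> moves from outside \<open>qc a b\<close> into
  q-commutators with \<open>a\<close> and with \<open>b\<close> separately, where the recursions for
  \<open>x\<close> and \<open>y\<close> apply.\<close>

lemma cm_qc_transfer: "cm (qc a b) g = cm a (qc b g) - cm (qc g a) b"
  by (simp add: cm_def qc_def expand_simps algebra_simps)

text \<open>The associator of the q-commutator is a double commutator.\<close>

lemma qc_qc_cm: "qc (qc a d) b - qc a (qc d b) = cm (cm a b) d"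
  by (simp add: cm_def qc_def expand_simps algebra_simps pq_simps)

text \<open>Since \<open>q * p = 1\<close>, the hypothesis is a three-term recurrence with middle
  coefficient \<open>q * q + p * p\<close>, hence with characteristic roots \<open>q * q\<close> and
  \<open>p * p\<close>. A solution starting at 0 is a multiple of
  \<open>(q * q) ^ k - (p * p) ^ k\<close>, which is nonzero for positive \<open>k\<close>, so a
  second zero kills it.\<close>

lemma recurrence_vanish:
  fixes e :: "nat \<Rightarrow> 'a"
  assumes root: "\<And>j. j > 0 \<Longrightarrow> q ^ j \<noteq> 1"
    and e0: "e 0 = 0" and eN: "e (n + 2) = 0"
    and rec: "\<And>k. k \<le> n \<Longrightarrow> e k + e (k + 1) + (e (k + 1) + e (k + 2)) = sc ((q + p) * (q + p)) (e (k + 1))"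
    and k: "k \<le> n + 2"
  shows "e k = 0"
proof -
  have step: "e (Suc (Suc k)) = sc (q * q + p * p) (e (Suc k)) - e k" if "k \<le> n" for k
    using rec[OF that] by (simp add: expand_simps sc_two algebra_simps pq_simps)
  \<comment> \<open>The factor \<open>q * q - p * p\<close> on the left avoids a division.\<close>
  have closed: "sc (q * q - p * p) (e k) = sc ((q * q) ^ k - (p * p) ^ k) (e 1)" if "k \<le> n + 2" for k
    using that
  proof (induction k rule: less_induct)
    case (less k)
    consider "k = 0" | "k = 1" | j where "k = Suc (Suc j)"
      by (metis One_nat_def not0_implies_Suc)
    then show ?case
    proof cases
      case 3
      have "sc (q * q - p * p) (e k) = sc (q * q + p * p) (sc (q * q - p * p) (e (Suc j))) - sc (q * q - p * p) (e j)"
        using 3 less.prems by (simp add: step sc_diff_right sc_sc mult.commute)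
      also have "\<dots> = sc ((q * q + p * p) * ((q * q) ^ Suc j - (p * p) ^ Suc j)) (e 1) - sc ((q * q) ^ j - (p * p) ^ j) (e 1)"
        using 3 less.prems less.IH[of "Suc j"] less.IH[of j] by (simp add: sc_sc)
      also have "\<dots> = sc ((q * q + p * p) * ((q * q) ^ Suc j - (p * p) ^ Suc j) - ((q * q) ^ j - (p * p) ^ j)) (e 1)"
        by (simp only: sc_diff_left)
      also have "(q * q + p * p) * ((q * q) ^ Suc j - (p * p) ^ Suc j) - ((q * q) ^ j - (p * p) ^ j)
        = (q * q) ^ k - (p * p) ^ k"
        using 3 by (simp add: algebra_simps pq_simps)
      finally show ?thesis .
    qed (simp_all add: e0)
  qed
  \<comment> \<open>Equality of the two powers would give \<open>q ^ (4 * j) = 1\<close>.\<close>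
  have "(q * q) ^ j - (p * p) ^ j \<noteq> 0" if "j > 0" for j
  proof
    assume "(q * q) ^ j - (p * p) ^ j = 0"
    then have "(q * q) ^ j * (q * q) ^ j = (p * p) ^ j * (q * q) ^ j"
      by simp
    also have "\<dots> = (p * p * (q * q)) ^ j"
      by (simp only: power_mult_distrib)
    also have "p * p * (q * q) = 1"
      by (simp add: mult.assoc pq_simps)
    finally have "q ^ (4 * j) = 1"
      by (simp add: power_add power_mult_distrib numeral_eq_Suc mult.assoc)
    then show False
      using root[of "4 * j"] that by simp
  qed
  then have ne: "(q * q) ^ (n + 2) - (p * p) ^ (n + 2) \<noteq> 0" "q * q - p * p \<noteq> 0"
    by (metis add_2_eq_Suc' zero_less_Suc, metis zero_less_one power_one_right)
  have "e 1 = 0"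
    using closed[of "n + 2"] eN ne by (simp add: sc_eq_0_iff)
  then show ?thesis
    using closed[OF k] ne by (simp add: sc_eq_0_iff)
qed

end

section \<open>The induction on the degree\<close>

text \<open>
  Here \<open>x k\<close>, \<open>y k\<close>, \<open>g k\<close> stand for \<open>W\<^bsub>-k\<^esub>\<close>, \<open>W\<^bsub>k+1\<^esub>\<close>, \<open>tG\<^bsub>k+1\<^esub>\<close>, and \<open>D k\<close> for
  \<open>(tG\<^bsub>k+1\<^esub> - G\<^bsub>k+1\<^esub>) / (q + 1/q)\<close>. The relations of even degree are assumed up to degree \<open>2n + 2\<close>,
  those of odd degree up to \<open>2m + 3\<close>. The scalar \<open>r\<close> plays the role of \<open>\<rho>\<close>, whose value is irrelevant
  as long as it is nonzero.
\<close>

locale level = qalg sc mul q p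
  for sc :: "'f::field \<Rightarrow> 'a::ab_group_add \<Rightarrow> 'a" and mul :: "'a \<Rightarrow> 'a \<Rightarrow> 'a" (infixl "\<cdot>" 70)
    and q p :: 'f +
  fixes r :: 'f and x y g D :: "nat \<Rightarrow> 'a" and n m :: nat
  assumes root: "\<And>j. j > 0 \<Longrightarrow> q ^ j \<noteq> 1"
    and r0: "r \<noteq> 0"
    and rec_x: "\<And>k. sc r (x (Suc k)) = sc r (y k) + qc (g k) (x 0)"
    and rec_y: "\<And>k. sc r (y (Suc k)) = sc r (x k) + qc (y 0) (g k)"
    and gg: "\<And>i j. cm (g i) (g j) = 0"
    and serre_x: "cm (x 0) (x 1) = 0"
    and serre_y: "cm (y 0) (y 1) = 0"
    and Dx: "\<And>i. i \<le> n \<Longrightarrow> cm (x i) (y 0) = D i"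
    and Dy: "\<And>i. i \<le> n \<Longrightarrow> cm (x 0) (y i) = D i"
    and xx: "\<And>i j. i + j \<le> n \<Longrightarrow> cm (x i) (x j) = 0"
    and yy: "\<And>i j. i + j \<le> n \<Longrightarrow> cm (y i) (y j) = 0"
    and xy: "\<And>i j. i + j \<le> n \<Longrightarrow> cm (x i) (y j) = cm (x j) (y i)"
    and gD: "\<And>i j. i + j < n \<Longrightarrow> cm (g i) (D j) = cm (g j) (D i)"
    and DD: "\<And>i j. i + j < n \<Longrightarrow> cm (D i) (D j) = 0"
    and xg: "\<And>i j. i + j \<le> m \<Longrightarrow> cm (x i) (g j) = cm (x j) (g i)"
    and yg: "\<And>i j. i + j \<le> m \<Longrightarrow> cm (y i) (g j) = cm (y j) (g i)"
    and ag: "\<And>i. i \<le> m \<Longrightarrow> cm (x 0) (g i) = qc (x 0) (D i)"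
    and gb: "\<And>i. i \<le> m \<Longrightarrow> cm (g i) (y 0) = qc (D i) (y 0)"
begin

text \<open>\<open>D\<close> is its own mirror image: reversal exchanges its two descriptions
  \<open>cm (x i) (y 0)\<close> and \<open>cm (x 0) (y i)\<close>. Hence results on \<open>x\<close>
  transfer to \<open>y\<close>.\<close>

lemma dual: "level sc (\<lambda>u v. v \<cdot> u) q p r y x g D n m"
proof -
  interpret op: qalg sc "\<lambda>u v. v \<cdot> u" q p
    by (rule opposite_qalg)
  have cm: "op.cm u v = cm v u" and qc: "op.qc u v = qc v u" for u v
    by (simp_all add: cm_def qc_def op.cm_def op.qc_def)
  show ?thesis
    apply unfold_locales
    unfolding cm qc
                     apply (fact root r0 rec_x rec_y gg serre_x serre_y Dx Dy)+
    subgoal using serre_y by (simp add: cm_eq_0_swap)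
    subgoal using serre_x by (simp add: cm_eq_0_swap)
    subgoal using Dy by simp
    subgoal using Dx by simp
    subgoal for i j using yy[of j i] by (simp add: add.commute)
    subgoal for i j using xx[of j i] by (simp add: add.commute)
    subgoal for i j using xy[of j i] by (simp add: add.commute)
    subgoal for i j using gD[of i j] by (metis cm_swap)
    subgoal for i j using DD[of j i] by (simp add: add.commute)
    subgoal for i j using yg[of i j] by (metis cm_swap)
    subgoal for i j using xg[of i j] by (metis cm_swap)
    subgoal using gb by simp
    subgoal using ag by simp
    done
qed

definition G :: "nat \<Rightarrow> 'a" where
  "G k = g k - sc (q + p) (D k)"

lemma qp_sum_nz: "q + p \<noteq> 0"
proof
  assume "q + p = 0"
  \<comment> \<open>By \<open>q * p = 1\<close> the left-hand side is
    \<open>q ^ 4 - 1\<close>.\<close>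
  then have "q * (q + p) * (q * (q + p) - 2) = 0"
    by simp
  then have "q * (q * (q * q)) = 1"
    by (simp add: algebra_simps pq_simps)
  then show False
    using root[of 4] by (simp add: numeral_eq_Suc)
qed

lemma gx: "sc r (x (Suc k) - y k) = qc (g k) (x 0)"
  using rec_x by (simp add: sc_diff_right)

lemma gy: "sc r (y (Suc k) - x k) = qc (y 0) (g k)"
  using rec_y by (simp add: sc_diff_right)

text \<open>A second expression of \<open>x (Suc k) - y k\<close> as a q-commutator, with
  \<open>G\<close> instead of \<open>g\<close>. The even step compares the two.\<close>

lemma aG:
  assumes "k \<le> m"
  shows "qc (x 0) (G k) = qc (g k) (x 0)"
proof -
  have "qc (x 0) (g k) - qc (g k) (x 0) = sc (q + p) (qc (x 0) (D k))"
    by (simp add: qc_antisym ag assms)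
  then show ?thesis
    by (simp add: G_def qc_linear algebra_simps)
qed

lemma Gb:
  assumes "k \<le> m"
  shows "qc (G k) (y 0) = qc (y 0) (g k)"
proof -
  have "qc (g k) (y 0) - qc (y 0) (g k) = sc (q + p) (qc (D k) (y 0))"
    by (simp add: qc_antisym gb assms)
  then show ?thesis
    by (simp add: G_def qc_linear algebra_simps)
qed

lemma GG:
  assumes "i + j < n"
  shows "cm (G i) (G j) = 0"
proof -
  have "cm (D i) (g j) = - cm (g i) (D j)"
    using gD[of j i] assms by (metis add.commute cm_swap)
  then show ?thesis
    using gD[OF assms] DD[OF assms] by (simp add: G_def cm_linear gg expand_simps algebra_simps)
qed

lemma gG_D: "g k - G k = sc (q + p) (D k)"
  by (simp add: G_def)

text \<open>Jacobi identity with \<open>y 0\<close> for the commuting elements \<open>x i\<close>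
  and \<open>x j\<close>.\<close>

lemma xD:
  assumes "i + j \<le> n" shows "cm (x i) (D j) = cm (x j) (D i)"
  using assms xx[OF assms] jacobi[of "x i" "x j" "y 0"] by (simp add: Dx flip: cm_linear) (simp add: Dx cm_linear)

lemma yD:
  assumes "i + j \<le> n" shows "cm (y i) (D j) = cm (y j) (D i)"
  using assms yy[OF assms] jacobi[of "y i" "x 0" "y j"]
  by (simp add: Dy cm_linear cm_swap[of "y i" "x 0"] cm_swap[of "D i"])

section \<open>Even degree: the defects \<open>R k\<close> and the commutators of the
  \<open>D k\<close>\<close>

definition R :: "nat \<Rightarrow> 'a" where
  "R k = sc r (cm (x k) (y (Suc n - k)) - cm (x (Suc n - k)) (y k))"

lemma R_flip: "k \<le> Suc n \<Longrightarrow> R (Suc n - k) = - R k"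
  by (simp add: R_def sc_diff_right)

text \<open>The cyclic identity turns the defect into the commutator of
  \<open>qc (x 0) (y 0)\<close> with \<open>g n\<close>; then \<open>ag\<close> and
  \<open>gb\<close> produce an associator, which \<open>qc_qc_cm\<close> evaluates.\<close>

lemma R_0:
  assumes nm: "n = m"
  shows "R 0 = cm (D 0) (D n)"
proof -
  have "R 0 = cm (x 0) (sc r (y (Suc n))) - cm (sc r (x (Suc n))) (y 0)"
    by (simp add: R_def cm_linear sc_diff_right)
  also have "\<dots> = cm (x 0) (qc (y 0) (g n)) - cm (qc (g n) (x 0)) (y 0)"
    unfolding rec_x rec_y by (simp add: cm_linear xx yy)
  also have "\<dots> = cm (qc (x 0) (y 0)) (g n)"
    by (rule cm_qc_transfer[symmetric])
  also have "\<dots> = qc (cm (x 0) (g n)) (y 0) - qc (x 0) (cm (g n) (y 0))"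
    by (simp add: cm_qc_left cm_swap[of "y 0" "g n"] qc_linear)
  also have "\<dots> = cm (D 0) (D n)"
    using Dx[of 0] by (simp add: ag gb nm qc_qc_cm)
  finally show ?thesis .
qed

text \<open>The differences \<open>?A\<close> and \<open>?B\<close> are multiples of q-commutators
  with \<open>g\<close> and also with \<open>G\<close>. The two forms evaluate q-commutators of
  \<open>?A\<close> and \<open>?B\<close> in opposite orders; subtracting leaves
  \<open>g - G\<close>, a multiple of \<open>D\<close>.\<close>

lemma R_interior:
  assumes nm: "n = m" and kl: "Suc (k + l) = n"
  shows "R (Suc k) = cm (D k) (D (Suc l)) + cm (D (Suc k)) (D l)"
proof -
  let ?A = "\<lambda>k. x (Suc k) - y k" and ?B = "\<lambda>k. y (Suc k) - x k"
  have bounds: "k \<le> m" "l \<le> m" "Suc k \<le> n" "Suc l \<le> n" "k + l < n"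
    using kl nm by auto
  have Ab: "cm (qc (g i) (x 0)) (y 0) = sc r (D (Suc i))" if "Suc i \<le> n" for i
    using that by (simp add: Dx yy cm_linear flip: gx)
  have "sc r (sc r (qc (?B k) (?A l) - qc (?B l) (?A k)))
      = qc (qc (y 0) (g k)) (qc (g l) (x 0)) - qc (qc (y 0) (g l)) (qc (g k) (x 0))"
    by (simp only: qc_scale_diff gx gy)
  also have "\<dots> = sc r (cm (g k) (D (Suc l)) - cm (g l) (D (Suc k)))"
    by (simp add: qc_exchange gg Ab bounds cm_linear sc_diff_right)
  finally have 1: "sc r (qc (?B k) (?A l) - qc (?B l) (?A k)) = cm (g k) (D (Suc l)) - cm (g l) (D (Suc k))"
    using r0 by (simp add: sc_cancel)
  have "sc r (sc r (qc (?A l) (?B k) - qc (?A k) (?B l)))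
      = qc (qc (x 0) (G l)) (qc (G k) (y 0)) - qc (qc (x 0) (G k)) (qc (G l) (y 0))"
    by (simp only: qc_scale_diff gx gy aG[OF bounds(1)] aG[OF bounds(2)] Gb[OF bounds(1)] Gb[OF bounds(2)])
  also have "\<dots> = cm (cm (y 0) (qc (g l) (x 0))) (G k) - cm (cm (y 0) (qc (g k) (x 0))) (G l)"
    using qc_exchange_opposite[of "G k" "G l" "x 0" "y 0"] GG[OF bounds(5)] by (simp add: aG bounds)
  also have "\<dots> = sc r (cm (G k) (D (Suc l)) - cm (G l) (D (Suc k)))"
    unfolding cm_swap[of "y 0"] cm_linear cm_swap[of _ "G k"] cm_swap[of _ "G l"]
    by (simp add: Ab bounds cm_linear sc_diff_right)
  finally have 2: "sc r (qc (?A l) (?B k) - qc (?A k) (?B l)) = cm (G k) (D (Suc l)) - cm (G l) (D (Suc k))"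
    using r0 by (simp add: sc_cancel)
  have "sc (q + p) (sc r (cm (?A k) (?B l) - cm (?A l) (?B k)))
     = sc r ((qc (?B k) (?A l) - qc (?B l) (?A k)) - (qc (?A l) (?B k) - qc (?A k) (?B l)))"
    unfolding qc_sum_cm by (simp add: sc_sc mult.commute)
  also have "\<dots> = cm (g k - G k) (D (Suc l)) - cm (g l - G l) (D (Suc k))"
    unfolding sc_diff_right[of r "_ - _" "_ - _"] 1 2 by (simp add: cm_linear)
  also have "\<dots> = sc (q + p) (cm (D k) (D (Suc l)) + cm (D (Suc k)) (D l))"
    unfolding gG_D by (simp add: cm_linear sc_diff_right sc_add_right cm_swap[of "D l"] sc_minus_right)
  finally have "sc r (cm (?A k) (?B l) - cm (?A l) (?B k)) = cm (D k) (D (Suc l)) + cm (D (Suc k)) (D l)"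
    using qp_sum_nz by (simp add: sc_cancel)
  \<comment> \<open>Only the top terms survive: all others lie in degrees already treated and vanish
    or cancel.\<close>
  moreover have "cm (?A k) (?B l) - cm (?A l) (?B k) = cm (x (Suc k)) (y (Suc l)) - cm (x (Suc l)) (y (Suc k))"
    using xx[of "Suc k" l] xx[of "Suc l" k] yy[of k "Suc l"] yy[of l "Suc k"] xy[of l k] bounds kl
    by (simp add: cm_linear cm_swap[of "y k" "x l"] cm_swap[of "y l" "x k"])
  moreover have "Suc n - Suc k = Suc l"
    using kl by simp
  ultimately show ?thesis
    by (simp add: R_def)
qed

text \<open>Here \<open>x (Suc k)\<close> is expanded with \<open>g\<close> and
  \<open>y (Suc k)\<close> with \<open>G\<close>. The first two terms are symmetric in
  \<open>k\<close> and \<open>l\<close>, and the last one antisymmetrises to a commutator of the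
  \<open>D k\<close>.\<close>

lemma R_Suc_mixed:
  assumes nm: "n = m" and kl: "k + l = n"
  shows "R (Suc k) = qc (cm (g k) (y l)) (x 0) + qc (cm (G k) (x l)) (y 0) + sc (q + p) (qc (D k) (D l))"
proof -
  have [simp]: "n - k = l"
    using kl by simp
  have "R (Suc k) = cm (sc r (x (Suc k))) (y l) - cm (x l) (sc r (y (Suc k)))"
    by (simp add: R_def cm_linear sc_diff_right)
  also have "\<dots> = cm (qc (g k) (x 0)) (y l) - cm (x l) (qc (G k) (y 0))"
    unfolding rec_x rec_y using xx[of l k] yy[of k l] kl nm by (simp add: cm_linear Gb)
  also have "\<dots> = qc (cm (g k) (y l)) (x 0) + qc (cm (G k) (x l)) (y 0) + qc (g k - G k) (D l)"
    using kl by (simp add: cm_qc_left cm_qc_right Dx Dy cm_swap[of "x l" "G k"] qc_linear)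
  finally show ?thesis
    by (simp add: gG_D qc_linear)
qed

text \<open>The expansion with \<open>g\<close> in both places; once the defects vanish, it yields
  the symmetry of \<open>cm (g k) (D l)\<close>.\<close>

lemma R_Suc_pure:
  assumes nm: "n = m" and kl: "k + l = n"
  shows "R (Suc k) = qc (cm (g k) (y l)) (x 0) + qc (y 0) (cm (g k) (x l)) + sc (q + p) (cm (g k) (D l))"
proof -
  have [simp]: "n - k = l"
    using kl by simp
  have "R (Suc k) = cm (sc r (x (Suc k))) (y l) - cm (x l) (sc r (y (Suc k)))"
    by (simp add: R_def cm_linear sc_diff_right)
  also have "\<dots> = cm (qc (g k) (x 0)) (y l) - cm (x l) (qc (y 0) (g k))"
    unfolding rec_x rec_y using xx[of l k] yy[of k l] kl nm by (simp add: cm_linear)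
  also have "\<dots> = qc (cm (g k) (y l)) (x 0) + qc (y 0) (cm (g k) (x l)) + (qc (g k) (D l) - qc (D l) (g k))"
    using kl by (simp add: cm_qc_left cm_qc_right Dx Dy cm_swap[of "x l" "g k"] qc_linear)
  finally show ?thesis
    by (simp add: qc_antisym)
qed

lemma gx_sym: "k + l \<le> m \<Longrightarrow> cm (g k) (x l) = cm (g l) (x k)"
  using xg[of l k] by (metis add.commute cm_swap)

lemma gy_sym: "k + l \<le> m \<Longrightarrow> cm (g k) (y l) = cm (g l) (y k)"
  using yg[of l k] by (metis add.commute cm_swap)

lemma Gx_sym:
  assumes "k + l \<le> m" "k + l \<le> n"
  shows "cm (G k) (x l) = cm (G l) (x k)"
  using gx_sym[OF assms(1)] xD[of k l] assms(2)
  by (simp add: G_def cm_linear cm_swap[of "D _" "x _"])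

text \<open>The flip turns the sum into a difference of two mixed expansions, whose symmetric terms
  cancel. One factor \<open>q + p\<close> comes from the expansion, the other from
  \<open>qc_antisym\<close>.\<close>

lemma R_adjacent:
  assumes nm: "n = m" and k: "k \<le> n"
  shows "R k + R (Suc k) = sc ((q + p) * (q + p)) (cm (D k) (D (n - k)))"
proof -
  define l where "l = n - k"
  have kl: "k + l = n" "l + k = n" and l: "Suc l = Suc n - k"
    using k by (auto simp: l_def)
  have "R (Suc k) - R (Suc l) = sc (q + p) (qc (D k) (D l) - qc (D l) (D k))"
    unfolding R_Suc_mixed[OF nm kl(1)] R_Suc_mixed[OF nm kl(2)]
    using gy_sym[of k l] Gx_sym[of k l] kl nm by (simp add: sc_diff_right)
  moreover have "R (Suc l) = - R k"
    using k by (simp add: l R_flip)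
  ultimately show ?thesis
    by (simp add: qc_antisym sc_sc add.commute flip: l_def)
qed

lemma DD_vanish:
  assumes nm: "n = m" and kl: "k + l = n"
  shows "cm (D k) (D l) = 0"
proof -
  \<comment> \<open>The sequence is shifted by one: \<open>e (Suc k)\<close> is
    \<open>cm (D k) (D (n - k))\<close>, and the zeros at 0 and \<open>n + 2\<close> are the
    boundary values of the recurrence.\<close>
  define e where "e k = (case k of 0 \<Rightarrow> 0 | Suc i \<Rightarrow> if i \<le> n then cm (D i) (D (n - i)) else 0)" for k
  have R_e: "R k = e k + e (Suc k)" if k: "k \<le> Suc n" for k
  proof -
    consider "k = 0" | "k = Suc n" | i where "k = Suc i" "i < n"
      using k by (metis not0_implies_Suc order_le_less not_less_eq)
    then show ?thesis
    proof cases
      \<comment> \<open>At the upper end the antisymmetry of \<open>R\<close> leads back to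
        \<open>R 0\<close>.\<close>
      case 2
      then show ?thesis
        using R_flip[of 0] by (simp add: e_def R_0[OF nm] cm_swap[of "D n" "D 0"])
    next
      case 3
      then obtain j where j: "n = Suc (i + j)"
        using less_imp_Suc_add by blast
      then have "n - i = Suc j" "n - Suc i = j"
        by auto
      then show ?thesis
        using 3 j R_interior[OF nm, of i j] by (simp add: e_def)
    qed (simp add: e_def R_0[OF nm])
  qed
  have "e (Suc k) = 0"
  proof (rule recurrence_vanish[where n = n])
    show "e i + e (i + 1) + (e (i + 1) + e (i + 2)) = sc ((q + p) * (q + p)) (e (i + 1))" if "i \<le> n" for i
      using R_adjacent[OF nm that] R_e[of i] R_e[of "Suc i"] that by (simp add: e_def)
  qed (use kl root in \<open>auto simp: e_def\<close>)
  then show ?thesis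
    using kl by (auto simp: e_def)
qed

lemma R_vanish:
  assumes nm: "n = m" and k: "k \<le> Suc n"
  shows "R k = 0"
proof -
  have step: "R (Suc i) = - R i" if "i \<le> n" for i
    using R_adjacent[OF nm that] DD_vanish[OF nm, of i "n - i"] that by (simp add: eq_neg_iff_add_eq_0 add.commute)
  show ?thesis
    using k
  proof (induction k)
    case 0
    then show ?case
      using R_0[OF nm] DD_vanish[OF nm, of 0 n] by simp
  next
    case (Suc k)
    then show ?case
      by (simp add: step)
  qed
qed

lemma xy_step:
  assumes nm: "n = m" and ij: "i + j = Suc n"
  shows "cm (x i) (y j) = cm (x j) (y i)"
proof -
  have "j = Suc n - i" "i \<le> Suc n"
    using ij by auto
  then show ?thesis
    using R_vanish[OF nm, of i] r0 by (simp add: R_def sc_eq_0_iff)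
qed

lemma gD_step:
  assumes nm: "n = m" and kl: "k + l = n"
  shows "cm (g k) (D l) = cm (g l) (D k)"
proof -
  have lk: "l + k = n"
    using kl by simp
  have "sc (q + p) (cm (g k) (D l)) = sc (q + p) (cm (g l) (D k))"
    using R_Suc_pure[OF nm kl] R_Suc_pure[OF nm lk] R_vanish[OF nm, of "Suc k"] R_vanish[OF nm, of "Suc l"]
      gy_sym[of k l] gx_sym[of k l] kl nm by simp (metis add_left_cancel)
  then show ?thesis
    using qp_sum_nz by (simp add: sc_cancel)
qed

section \<open>Even degree: the commutators of \<open>x i\<close> with \<open>x j\<close>\<close>

lemma xx_shift:
  assumes nm: "n = m" and kl: "k + l = n"
  shows "cm (x (Suc k)) (x l) = cm (x (Suc l)) (x k)"
proof -
  have *: "sc r (cm (x (Suc i)) (x j)) = sc r (cm (y i) (x j)) + qc (cm (g i) (x j)) (x 0)"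
    if "i + j = n" for i j
  proof -
    have "sc r (cm (x (Suc i)) (x j)) = cm (sc r (y i) + qc (g i) (x 0)) (x j)"
      unfolding rec_x[symmetric] by (simp add: cm_linear)
    then show ?thesis
      using that xx[of 0 j] by (simp add: cm_linear cm_qc_left qc_linear)
  qed
  have "cm (y k) (x l) = cm (y l) (x k)"
    using xy[of l k] kl by (metis add.commute cm_swap order_refl)
  \<comment> \<open>Both terms of the expansion are symmetric in \<open>k\<close> and
    \<open>l\<close>.\<close>
  then have "sc r (cm (x (Suc k)) (x l)) = sc r (cm (x (Suc l)) (x k))"
    using *[of k l] *[of l k] gx_sym[of k l] kl nm by simp
  then show ?thesis
    using r0 by (simp add: sc_cancel)
qed

text \<open>\<open>cm_of_qc\<close> shows that the commutator of \<open>?A k\<close> and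
  \<open>?A l\<close>, times \<open>r\<close>, is \<open>- u\<close>. Expanding it, the commutators
  of \<open>x\<close> with \<open>y\<close> already contribute \<open>- u\<close>, so nothing is
  left for \<open>x\<close> with \<open>x\<close>.\<close>

lemma xx_interior:
  assumes nm: "n = m" and kl: "Suc (k + l) = n"
  shows "cm (x (Suc k)) (x (Suc l)) = 0"
proof -
  let ?A = "\<lambda>k. x (Suc k) - y k"
  define u where "u = qc (g k) (D l) - qc (g l) (D k)"
  have Aa: "cm (qc (g i) (x 0)) (x 0) = sc r (D i)" if "Suc i \<le> n" for i
    using that xx[of "Suc i" 0] by (simp add: cm_linear Dy cm_swap[of "y i"] flip: gx)
  have g: "cm (g k) (D l) = cm (g l) (D k)"
    using gD kl by simp
  have "sc (q + p) (sc (r * r) (cm (?A k) (?A l))) + sc r (sc (q + p) u)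
     = sc (q + p) (cm (qc (g k) (x 0)) (qc (g l) (x 0)))
    + (sc (q * q) (g k \<cdot> sc r (D l)) - sc (p * p) (sc r (D l) \<cdot> g k))
    - (sc (q * q) (g l \<cdot> sc r (D k)) - sc (p * p) (sc r (D k) \<cdot> g l))"
    unfolding u_def qc_skew_expand[OF g, symmetric] gx[symmetric]
    by (simp add: cm_linear sc_sc sc_mul_left sc_mul_right sc_diff_right mult_ac)
  also have "\<dots> = 0"
    using cm_of_qc[of "g k" "g l" "x 0"] Aa[of k] Aa[of l] kl by (simp add: gg)
  finally have "sc ((q + p) * r) (sc r (cm (?A k) (?A l)) + u) = 0"
    by (simp add: sc_add_right sc_sc mult_ac)
  then have 1: "sc r (cm (?A k) (?A l)) + u = 0"
    using qp_sum_nz r0 by (simp add: sc_eq_0_iff)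
  have *: "sc r (cm (x (Suc i)) (y j)) = qc (cm (g i) (y j)) (x 0) + qc (g i) (D j)"
    if "Suc (i + j) = n" for i j
  proof -
    have "sc r (cm (x (Suc i)) (y j)) = cm (sc r (y i) + qc (g i) (x 0)) (y j)"
      unfolding rec_x[symmetric] by (simp add: cm_linear)
    then show ?thesis
      using that yy[of i j] by (simp add: cm_linear cm_qc_left Dy)
  qed
  have 2: "sc r (cm (x (Suc k)) (y l) - cm (x (Suc l)) (y k)) = u"
    using *[of k l] *[of l k] gy_sym[of k l] kl nm by (simp add: u_def sc_diff_right)
  have "cm (?A k) (?A l) = cm (x (Suc k)) (x (Suc l)) - (cm (x (Suc k)) (y l) - cm (x (Suc l)) (y k))"
    using yy[of k l] kl by (simp add: cm_linear cm_swap[of "y k" "x (Suc l)"])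
  then have "sc r (cm (x (Suc k)) (x (Suc l))) = 0"
    using 1 2 by (simp add: sc_diff_right)
  then show ?thesis
    using r0 by (simp add: sc_eq_0_iff)
qed

lemma xx_step:
  assumes nm: "n = m" and ij: "i + j = Suc n"
  shows "cm (x i) (x j) = 0"
proof -
  have end_case: "cm (x (Suc n)) (x 0) = 0"
  proof (cases n)
    \<comment> \<open>For \<open>n = 0\<close> there is no interior pair to shift to, which is why
      \<open>serre_x\<close> is a separate hypothesis.\<close>
    case 0
    then show ?thesis
      using serre_x by (simp add: cm_eq_0_swap)
  next
    case (Suc n')
    then show ?thesis
      using xx_shift[OF nm, of n 0] xx_interior[OF nm, of 0 n'] by simp
  qed
  consider "i = 0" | "j = 0" | k l where "i = Suc k" "j = Suc l"
    by (metis old.nat.exhaust)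
  then show ?thesis
  proof cases
    case 3
    then show ?thesis
      using xx_interior[OF nm, of k l] ij by simp
  qed (use end_case ij in \<open>auto simp: cm_eq_0_swap[of "x 0"]\<close>)
qed

text \<open>\<open>D\<close> is unconstrained beyond index \<open>n\<close>, hence the assumption
  that fixes its next value. The relations for \<open>y\<close> come from the mirror image.\<close>

lemma even_step:
  assumes nm: "n = m" and D: "D (Suc n) = cm (x 0) (y (Suc n))"
  shows "level sc mul q p r x y g D (Suc n) m"
proof -
  interpret op: level sc "\<lambda>u v. v \<cdot> u" q p r y x g D n m
    by (rule dual)
  have yy_step: "cm (y i) (y j) = 0" if "i + j = Suc n" for i j
    using op.xx_step[OF nm that] by (simp add: op.cm_def cm_def)
  show ?thesis
  proof
    show "cm (x i) (y 0) = D i" if "i \<le> Suc n" for i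
      using that Dx[of i] D xy_step[OF nm, of "Suc n" 0] by (auto simp: le_Suc_eq)
    show "cm (x 0) (y i) = D i" if "i \<le> Suc n" for i
      using that Dy[of i] D by (auto simp: le_Suc_eq)
    show "cm (x i) (x j) = 0" if "i + j \<le> Suc n" for i j
      using that xx xx_step[OF nm] by (auto simp: le_Suc_eq)
    show "cm (y i) (y j) = 0" if "i + j \<le> Suc n" for i j
      using that yy yy_step by (auto simp: le_Suc_eq)
    show "cm (x i) (y j) = cm (x j) (y i)" if "i + j \<le> Suc n" for i j
      using that xy xy_step[OF nm] unfolding le_Suc_eq by blast
    show "cm (g i) (D j) = cm (g j) (D i)" if "i + j < Suc n" for i j
      using that gD gD_step[OF nm] unfolding less_Suc_eq by blast
    show "cm (D i) (D j) = 0" if "i + j < Suc n" for i j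
      using that DD DD_vanish[OF nm] unfolding less_Suc_eq by blast
  qed (fact root r0 rec_x rec_y gg serre_x serre_y xg yg ag gb)+
qed

section \<open>Odd degree: the commutators of \<open>x i\<close> and \<open>y i\<close> with
  \<open>g j\<close>\<close>

lemma ag_step:
  assumes nm: "n = Suc m"
    and v: "sc r (cm (x 0) (g n)) = cm (x 0) (qc (x 0) (qc (y 0) (g m)))"
  shows "cm (x 0) (g n) = qc (x 0) (D n)"
proof -
  \<comment> \<open>The inner q-commutator is \<open>r\<close> times \<open>y n - x m\<close>, and
    \<open>cm (x 0)\<close> acts as a derivation on the outer one. Afterwards \<open>x m\<close>
    drops out because it commutes with \<open>x 0\<close>.\<close>
  have "sc r (cm (x 0) (g n)) = sc r (qc (x 0) (cm (x 0) (y n - x m)))"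
    unfolding nm v[unfolded nm] gy[symmetric] by (simp add: cm_linear qc_linear cm_qc_right)
  then show ?thesis
    using r0 xx[of 0 m] Dy[of n] nm by (simp add: sc_cancel cm_linear)
qed

text \<open>By the cyclic identity \<open>qc (x 0) (y 0)\<close> commutes with \<open>g j\<close>,
  because both resulting commutators involve the same \<open>D (Suc j)\<close>. So the element
  commutes with \<open>g j\<close>, and the recursions carry the claim from \<open>j\<close> to
  \<open>Suc j\<close>.\<close>

lemma central_g0:
  assumes nm: "n = Suc m" and j: "j \<le> n"
  shows "cm (x j) (g 0 - qc (x 0) (y 0)) = 0 \<and> cm (y j) (g 0 - qc (x 0) (y 0)) = 0"
proof -
  let ?z = "g 0 - qc (x 0) (y 0)"
  have "cm (y 0) (g 0) = - cm (g 0) (y 0)"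
    by (rule cm_swap)
  then have "cm (y 0) (g 0) = qc (cm (y 0) (x 0)) (y 0)"
    using Dx[of 0] by (simp add: gb cm_swap[of "y 0" "x 0"] qc_linear)
  then have z0: "cm (x 0) ?z = 0" "cm (y 0) ?z = 0"
    using Dx[of 0] by (simp_all add: cm_linear ag cm_qc_right qc_linear)
  show ?thesis
    using j
  proof (induction j)
    case 0
    then show ?case
      using z0 by simp
  next
    case (Suc j)
    have z: "cm (x j) ?z = 0" "cm (y j) ?z = 0" "cm (x 0) ?z = 0" "cm (y 0) ?z = 0"
      using Suc z0 by auto
    have "cm (qc (x 0) (y 0)) (g j) = sc r (cm (x 0) (y (Suc j) - x j) - cm (x (Suc j) - y j) (y 0))"
      unfolding cm_qc_transfer gx[symmetric] gy[symmetric] by (simp add: cm_linear sc_diff_right)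
    also have "\<dots> = 0"
      using Suc.prems xx[of 0 j] yy[of j 0] by (simp add: cm_linear Dx Dy)
    finally have gz: "cm (g j) ?z = 0"
      by (simp add: cm_linear gg cm_swap[of "g j" "qc _ _"])
    have "sc r (cm (x (Suc j)) ?z) = cm (sc r (x (Suc j))) ?z" "sc r (cm (y (Suc j)) ?z) = cm (sc r (y (Suc j))) ?z"
      by (simp_all add: cm_linear(7))
    then have "sc r (cm (x (Suc j)) ?z) = 0" "sc r (cm (y (Suc j)) ?z) = 0"
      unfolding rec_x rec_y cm_linear(1,7) cm_qc_left gz z by (simp_all add: qc_linear)
    then show ?case
      using r0 by (simp add: sc_eq_0_iff)
  qed
qed

text \<open>In the end case \<open>g 0\<close> may be replaced by \<open>qc (x 0) (y 0)\<close>, and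
  both sides become \<open>qc (x 0) (D n)\<close>. Otherwise the recursions unfold the commutator
  until it is visibly symmetric.\<close>

lemma xg_step:
  assumes nm: "n = Suc m" and ag': "cm (x 0) (g n) = qc (x 0) (D n)"
    and ij: "i + j = n"
  shows "cm (x i) (g j) = cm (x j) (g i)"
proof -
  have end_case: "cm (x 0) (g n) = cm (x n) (g 0)"
  proof -
    have "cm (x n) (g 0) = cm (x n) (qc (x 0) (y 0))"
      using central_g0[OF nm, of n] by (simp add: cm_linear)
    also have "\<dots> = qc (x 0) (D n)"
      using xx[of n 0] by (simp add: cm_qc_right qc_linear Dx)
    finally show ?thesis
      using ag' by simp
  qed
  have M: "sc r (cm (qc (g k) (x (Suc l))) (g 0))
      = sc r (qc (g k) (cm (y 0) (g l))) + cm (qc (g k) (qc (g l) (x 0))) (g 0)"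
    if "Suc (k + l) = m" for k l
  proof -
    have "sc r (cm (qc (g k) (x (Suc l))) (g 0)) = cm (qc (g k) (sc r (y l) + qc (g l) (x 0))) (g 0)"
      unfolding rec_x[symmetric] by (simp add: cm_linear qc_linear)
    also have "\<dots> = sc r (qc (g k) (cm (y l) (g 0))) + cm (qc (g k) (qc (g l) (x 0))) (g 0)"
      unfolding qc_linear cm_linear cm_qc_left[of "g k" "y l"] gg by (simp add: qc_linear)
    finally show ?thesis
      using yg[of l 0] that by simp
  qed
  have X: "sc r (cm (x (Suc k)) (g (Suc l)))
      = sc r (cm (x l) (g k)) + cm (qc (y 0) (g l)) (g k) + cm (qc (g k) (x (Suc l))) (g 0)"
    if "Suc (k + l) = m" for k l
  proof -
    have "sc r (cm (x (Suc k)) (g (Suc l))) = cm (sc r (y k) + qc (g k) (x 0)) (g (Suc l))"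
      unfolding rec_x[symmetric] by (simp add: cm_linear)
    also have "\<dots> = sc r (cm (y k) (g (Suc l))) + qc (g k) (cm (x 0) (g (Suc l)))"
      by (simp add: cm_linear cm_qc_left gg qc_linear)
    \<comment> \<open>Moving the index to \<open>x\<close> leaves \<open>g 0\<close>, which commutes
      with \<open>g k\<close> and can be pulled out of the q-commutator.\<close>
    also have "cm (x 0) (g (Suc l)) = cm (x (Suc l)) (g 0)"
      using xg[of 0 "Suc l"] that by simp
    also have "qc (g k) (cm (x (Suc l)) (g 0)) = cm (qc (g k) (x (Suc l))) (g 0)"
      by (simp add: cm_qc_left gg qc_linear)
    also have "sc r (cm (y k) (g (Suc l))) = cm (sc r (y (Suc l))) (g k)"
      using yg[of k "Suc l"] that by (simp add: cm_linear)
    also have "\<dots> = sc r (cm (x l) (g k)) + cm (qc (y 0) (g l)) (g k)"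
      unfolding rec_y by (simp add: cm_linear)
    finally show ?thesis .
  qed
  have interior: "cm (x (Suc k)) (g (Suc l)) = cm (x (Suc l)) (g (Suc k))" if kl: "Suc (k + l) = m" for k l
  proof -
    have lk: "Suc (l + k) = m"
      using kl by simp
    have "sc r (sc r (cm (x (Suc k)) (g (Suc l)))) = sc r (sc r (cm (x l) (g k)))
      + sc r (cm (qc (y 0) (g l)) (g k) + qc (g k) (cm (y 0) (g l))) + cm (qc (g k) (qc (g l) (x 0))) (g 0)"
      unfolding X[OF kl] sc_add_right M[OF kl] by (simp add: add.assoc)
    \<comment> \<open>Each term is symmetric: the first by the case of lower degree, the others
      because \<open>g k\<close> and \<open>g l\<close> commute.\<close>
    also have "\<dots> = sc r (sc r (cm (x k) (g l)))
      + sc r (cm (qc (y 0) (g k)) (g l) + qc (g l) (cm (y 0) (g k))) + cm (qc (g l) (qc (g k) (x 0))) (g 0)"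
      using xg[of k l] kl cm_qc_sym[OF gg, of "y 0" l k] qc_qc_commute[OF gg, of k l "x 0"] by simp
    also have "\<dots> = sc r (sc r (cm (x (Suc l)) (g (Suc k))))"
      unfolding X[OF lk] sc_add_right M[OF lk] by (simp add: add.assoc)
    finally show ?thesis
      using r0 by (simp add: sc_cancel)
  qed
  consider "i = 0" | "j = 0" | k l where "i = Suc k" "j = Suc l"
    by (metis old.nat.exhaust)
  then show ?thesis
  proof cases
    case 3
    then show ?thesis
      using interior[of k l] ij nm by simp
  qed (use end_case ij in auto)
qed

lemma odd_step:
  assumes nm: "n = Suc m"
    and v: "sc r (cm (x 0) (g n)) = cm (x 0) (qc (x 0) (qc (y 0) (g m)))"
    and vi: "sc r (cm (g n) (y 0)) = cm (qc (qc (g m) (x 0)) (y 0)) (y 0)"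
  shows "level sc mul q p r x y g D n (Suc m)"
proof -
  interpret op: level sc "\<lambda>u v. v \<cdot> u" q p r y x g D n m
    by (rule dual)
  have cm: "op.cm u v = cm v u" and qc: "op.qc u v = qc v u" for u v
    by (simp_all add: cm_def qc_def op.cm_def op.qc_def)
  have ag': "cm (x 0) (g n) = qc (x 0) (D n)"
    by (rule ag_step[OF nm v])
  have gb': "cm (g n) (y 0) = qc (D n) (y 0)"
    using op.ag_step[OF nm] vi by (simp add: cm qc)
  have yg': "cm (y i) (g j) = cm (y j) (g i)" if "i + j = n" for i j
    using op.xg_step[OF nm _ that] gb' by (metis cm qc cm_swap)
  show ?thesis
  proof
    show "cm (x i) (g j) = cm (x j) (g i)" if "i + j \<le> Suc m" for i j
      using that xg xg_step[OF nm ag'] nm unfolding le_Suc_eq by blast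
    show "cm (y i) (g j) = cm (y j) (g i)" if "i + j \<le> Suc m" for i j
      using that yg yg' nm unfolding le_Suc_eq by blast
    show "cm (x 0) (g i) = qc (x 0) (D i)" if "i \<le> Suc m" for i
      using that ag ag' nm unfolding le_Suc_eq by blast
    show "cm (g i) (y 0) = qc (D i) (y 0)" if "i \<le> Suc m" for i
      using that gb gb' nm unfolding le_Suc_eq by blast
  qed (fact root r0 rec_x rec_y gg serre_x serre_y xx yy xy gD DD Dx Dy)+
qed

end

section \<open>Equivalence of the two presentations\<close>

locale alternating = qalg sc mul q p
  for sc :: "'f::field \<Rightarrow> 'a::ab_group_add \<Rightarrow> 'a" and mul :: "'a \<Rightarrow> 'a \<Rightarrow> 'a" (infixl "\<cdot>" 70)
    and q p :: 'f +
  fixes r :: 'f and x y G g :: "nat \<Rightarrow> 'a"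
  assumes ay: "\<And>k. cm (x 0) (y k) = sc (inverse (q + p)) (g k - G k)"
    and xb: "\<And>k. cm (x k) (y 0) = sc (inverse (q + p)) (g k - G k)"
    and aG: "\<And>k. qc (x 0) (G k) = sc r (x (Suc k)) - sc r (y k)"
    and ga: "\<And>k. qc (g k) (x 0) = sc r (x (Suc k)) - sc r (y k)"
    and Gb: "\<And>k. qc (G k) (y 0) = sc r (y (Suc k)) - sc r (x k)"
    and bg: "\<And>k. qc (y 0) (g k) = sc r (y (Suc k)) - sc r (x k)"
    and xx: "\<And>k l. cm (x k) (x l) = 0"
    and yy: "\<And>k l. cm (y k) (y l) = 0"
    and xy: "\<And>k l. cm (x k) (y l) + cm (y k) (x l) = 0"
    and xG: "\<And>k l. cm (x k) (G l) + cm (G k) (x l) = 0"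
    and xg: "\<And>k l. cm (x k) (g l) + cm (g k) (x l) = 0"
    and yG: "\<And>k l. cm (y k) (G l) + cm (G k) (y l) = 0"
    and yg: "\<And>k l. cm (y k) (g l) + cm (g k) (y l) = 0"
    and GG: "\<And>k l. cm (G k) (G l) = 0"
    and gg: "\<And>k l. cm (g k) (g l) = 0"
    and gG: "\<And>k l. cm (g k) (G l) + cm (G k) (g l) = 0"
begin

lemma dual: "alternating sc (\<lambda>u v. v \<cdot> u) q p r y x G g"
proof -
  interpret op: qalg sc "\<lambda>u v. v \<cdot> u" q p
    by (rule opposite_qalg)
  have cm: "op.cm u v = cm v u" and qc: "op.qc u v = qc v u" for u v
    by (simp_all add: cm_def qc_def op.cm_def op.qc_def)
  show ?thesis
    by unfold_locales (simp_all only: cm qc ay xb aG ga Gb bg xx yy GG gg,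
        simp_all only: xy xG xg yG yg gG add.commute[of "cm (G _) _"] add.commute[of "cm (g _) (y _)"]
        add.commute[of "cm (g _) (x _)"] add.commute[of "cm (y _) (x _)"])
qed

text \<open>\<open>qc (g k) (x 0)\<close> and \<open>qc (x 0) (G k)\<close> have the same value, so
  \<open>qc_antisym\<close> leaves a q-commutator with \<open>g k - G k\<close>, which is a multiple
  of \<open>cm (x 0) (y k)\<close>.\<close>

lemma ag_D:
  assumes "q + p \<noteq> 0"
  shows "cm (x 0) (g k) = qc (x 0) (cm (x 0) (y k))"
proof -
  have "sc (q + p) (cm (x 0) (g k)) = qc (x 0) (g k) - qc (x 0) (G k)"
    unfolding aG by (simp add: qc_antisym flip: ga)
  also have "\<dots> = sc (q + p) (qc (x 0) (cm (x 0) (y k)))"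
    using assms by (simp add: ay qc_linear sc_sc sc_one)
  finally show ?thesis
    using assms by (simp add: sc_cancel)
qed

lemma compact_v:
  assumes "q + p \<noteq> 0"
  shows "sc r (cm (x 0) (g (Suc k))) = cm (x 0) (qc (x 0) (qc (y 0) (g k)))"
  by (simp add: ag_D[OF assms] bg cm_linear qc_linear cm_qc_right xx)

lemma compact_iii:
  assumes "q + p \<noteq> 0"
  shows "cm (x 0) (g 0) = cm (x 0) (qc (x 0) (y 0))"
  by (simp add: ag_D[OF assms] qc_linear cm_qc_right)

text \<open>Only the commutator of \<open>qc (x 0) (y 0)\<close> with \<open>x 0\<close> matters, so
  (iii) allows \<open>g 0\<close> in its place, and \<open>ga\<close> applies.\<close>

lemma compact_i:
  assumes "q + p \<noteq> 0"
  shows "cm (x 0) (qc (qc (x 0) (y 0)) (x 0)) = sc r (cm (y 0) (x 0))"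
proof -
  have "cm (x 0) (qc (qc (x 0) (y 0)) (x 0)) = cm (x 0) (qc (g 0) (x 0))"
    by (simp add: cm_qc_right[of _ _ "x 0"] qc_linear compact_iii assms)
  also have "\<dots> = sc r (cm (y 0) (x 0))"
    by (simp add: ga cm_linear xx cm_swap[of "y 0" "x 0"] sc_minus_right)
  finally show ?thesis .
qed

end

section \<open>The compact relations imply the alternating ones\<close>

locale compact = qalg sc mul q p
  for sc :: "'f::field \<Rightarrow> 'a::ab_group_add \<Rightarrow> 'a" and mul :: "'a \<Rightarrow> 'a \<Rightarrow> 'a" (infixl "\<cdot>" 70)
    and q p :: 'f +
  fixes r :: 'f and a b :: 'a and g :: "nat \<Rightarrow> 'a"
  assumes root: "\<And>j. j > 0 \<Longrightarrow> q ^ j \<noteq> 1"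
    and r0: "r \<noteq> 0"
    and i: "cm a (qc (qc a b) a) = sc r (cm b a)"
    and ii: "cm b (qc (qc b a) b) = sc r (cm a b)"
    and iii: "cm a (g 0) = cm a (qc a b)"
    and iv: "cm (g 0) b = cm (qc a b) b"
    and v: "\<And>k. sc r (cm a (g (Suc k))) = cm a (qc a (qc b (g k)))"
    and vi: "\<And>k. sc r (cm (g (Suc k)) b) = cm (qc (qc (g k) a) b) b"
    and vii: "\<And>k l. cm (g k) (g l) = 0"
begin

text \<open>The recursion is forced: it solves the relations for \<open>qc (g k) (x 0)\<close> and
  \<open>qc (y 0) (g k)\<close> for the elements of the next index. The two sequences feed each
  other, hence the pair.\<close>

primrec xy :: "nat \<Rightarrow> 'a \<times> 'a" where
  "xy 0 = (a, b)"
| "xy (Suc k) = (snd (xy k) + sc (inverse r) (qc (g k) a), fst (xy k) + sc (inverse r) (qc b (g k)))"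

abbreviation x where "x k \<equiv> fst (xy k)"
abbreviation y where "y k \<equiv> snd (xy k)"
abbreviation D where "D k \<equiv> cm a (y k)"

text \<open>Each pass makes an even step and then an odd step. In the base case
  \<open>serre_x\<close> and \<open>serre_y\<close> are (i) and (ii), after (iii) and (iv) have
  replaced \<open>g 0\<close> by \<open>qc a b\<close>.\<close>

lemma level_all: "level sc mul q p r x y g D n n"
proof (induction n)
  case 0
  have rec: "sc r (x (Suc k)) = sc r (y k) + qc (g k) a" "sc r (y (Suc k)) = sc r (x k) + qc b (g k)" for k
    using r0 by (simp_all add: sc_add_right sc_sc sc_one)
  have "sc r (cm a (x 1)) = 0"
  proof -
    have "sc r (cm a (x 1)) = sc r (cm a b) + cm a (qc (g 0) a)"
      using r0 by (simp add: cm_linear sc_add_right sc_sc sc_one)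
    also have "cm a (qc (g 0) a) = cm a (qc (qc a b) a)"
      by (simp add: cm_qc_right[of _ _ a] qc_linear iii)
    finally show ?thesis
      by (simp add: i cm_swap[of b a] sc_minus_right)
  qed
  moreover have "sc r (cm b (y 1)) = 0"
  proof -
    have "sc r (cm b (y 1)) = sc r (cm b a) + cm b (qc b (g 0))"
      using r0 by (simp add: cm_linear sc_add_right sc_sc sc_one)
    also have "cm b (qc b (g 0)) = cm b (qc b (qc a b))"
      using iv by (simp add: cm_qc_right[of _ b] qc_linear cm_swap[of b])
    also have "qc b (qc a b) = qc (qc b a) b"
      by (simp add: qc_def expand_simps algebra_simps pq_simps)
    finally show ?thesis
      by (simp add: ii cm_swap[of b a] sc_minus_right)
  qed
  ultimately show ?case
    using r0 by unfold_locales
      (auto simp: root rec vii sc_eq_0_iff iii iv cm_qc_right cm_qc_left qc_linear simp del: xy.simps(2))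
next
  case (Suc n)
  interpret even: level sc mul q p r x y g D n n
    by (fact Suc)
  interpret odd: level sc mul q p r x y g D "Suc n" n
    by (rule even.even_step) simp_all
  show ?case
    by (rule odd.odd_step) (simp_all add: v vi del: xy.simps(2))
qed

definition G :: "nat \<Rightarrow> 'a" where
  "G k = g k - sc (q + p) (D k)"

lemma alternating: "alternating sc mul q p r x y G g"
proof -
  have nz: "q + p \<noteq> 0"
    by (rule level.qp_sum_nz[OF level_all])
  have Geq: "G k = level.G sc q p g D k" for k
    by (simp add: G_def level.G_def[OF level_all])
  show ?thesis
  proof
    fix k l
    show "cm (x 0) (y k) = sc (inverse (q + p)) (g k - G k)"
      using nz by (simp add: G_def sc_sc sc_one)
    show "cm (x k) (y 0) = sc (inverse (q + p)) (g k - G k)"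
      using nz level.Dx[OF level_all[of k], of k] by (simp add: G_def sc_sc sc_one)
    show ga: "qc (g k) (x 0) = sc r (x (Suc k)) - sc r (y k)"
      using level.rec_x[OF level_all] by simp
    show "qc (x 0) (G k) = sc r (x (Suc k)) - sc r (y k)"
      using level.aG[OF level_all[of k], of k] ga by (simp add: Geq)
    show bg: "qc (y 0) (g k) = sc r (y (Suc k)) - sc r (x k)"
      using level.rec_y[OF level_all] by simp
    show "qc (G k) (y 0) = sc r (y (Suc k)) - sc r (x k)"
      using level.Gb[OF level_all[of k], of k] bg by (simp add: Geq)
    show "cm (x k) (x l) = 0" "cm (y k) (y l) = 0"
      using level.xx[OF level_all[of "k + l"]] level.yy[OF level_all[of "k + l"]] by auto
    show "cm (x k) (y l) + cm (y k) (x l) = 0"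
      using level.xy[OF level_all[of "k + l"], of k l] by (simp add: cm_swap[of "y k"])
    have xg: "cm (x k) (g l) = cm (x l) (g k)" and yg: "cm (y k) (g l) = cm (y l) (g k)"
      using level.xg[OF level_all[of "k + l"], of k l] level.yg[OF level_all[of "k + l"], of k l] by auto
    show "cm (x k) (g l) + cm (g k) (x l) = 0"
      using xg by (simp add: cm_swap[of "g k"])
    show "cm (y k) (g l) + cm (g k) (y l) = 0"
      using yg by (simp add: cm_swap[of "g k"])
    have xD: "cm (x k) (D l) = cm (x l) (D k)"
      using level.xD[OF level_all[of "k + l"], of k l] by simp
    have yD: "cm (y k) (D l) = cm (y l) (D k)"
      using level.yD[OF level_all[of "k + l"], of k l] by simp
    show "cm (x k) (G l) + cm (G k) (x l) = 0"
      using xg xD by (simp add: G_def cm_linear cm_swap[of _ "x l"])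
    show "cm (y k) (G l) + cm (G k) (y l) = 0"
      using yg yD by (simp add: G_def cm_linear cm_swap[of _ "y l"])
    \<comment> \<open>The bound for products of two even elements is strict, so one level more than
      \<open>k + l\<close> is taken.\<close>
    show "cm (G k) (G l) = 0"
      using level.GG[OF level_all[of "Suc (k + l)"], of k l] by (simp add: Geq)
    show "cm (g k) (g l) = 0"
      by (rule vii)
    have "cm (g k) (D l) = cm (g l) (D k)"
      using level.gD[OF level_all[of "Suc (k + l)"], of k l] by simp
    then show "cm (g k) (G l) + cm (G k) (g l) = 0"
      by (simp add: G_def cm_linear vii cm_swap[of _ "g l"] sc_minus_right)
  qed
qed

end

text \<open>Half of the relations are mirror images of the others; \<open>swap\<close> brings the
  mirrored double q-commutator of (ii) into the required form.\<close>

lemma (in alternating) compact: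
  assumes root: "\<And>j. j > 0 \<Longrightarrow> q ^ j \<noteq> 1" and r0: "r \<noteq> 0" and nz: "q + p \<noteq> 0"
  shows "compact sc mul q p r (x 0) (y 0) g"
proof -
  interpret op: alternating sc "\<lambda>u v. v \<cdot> u" q p r y x G g
    by (rule dual)
  have cm: "op.cm u v = cm v u" and qc: "op.qc u v = qc v u" for u v
    by (simp_all add: cm_def qc_def op.cm_def op.qc_def)
  have swap: "qc b (qc a b) = qc (qc b a) b" for a b
    by (simp add: qc_def expand_simps algebra_simps pq_simps)
  show ?thesis
    using compact_v[OF nz] compact_iii[OF nz] compact_i[OF nz]
      op.compact_v[OF nz, unfolded cm qc] op.compact_iii[OF nz, unfolded cm qc] op.compact_i[OF nz, unfolded cm qc]
    by unfold_locales (simp_all add: root r0 gg swap cm_swap[of "y 0"] sc_minus_right)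
qed

section \<open>A type containing every algebra\<close>

text \<open>
  The algebras to be compared depend on the value \<open>q\<close> and hence are not types. The product of all
  algebras with carrier in a given type is a type, and each of them embeds into it.
\<close>

locale central_algebra = ring R for R :: "'c ring" (structure) +
  fixes \<sigma> :: "'f::field \<Rightarrow> 'c"
  assumes scalar_closed: "\<sigma> c \<in> carrier R"
    and scalar_add: "\<sigma> (c + d) = \<sigma> c \<oplus> \<sigma> d"
    and scalar_mult: "\<sigma> (c * d) = \<sigma> c \<otimes> \<sigma> d"
    and scalar_one: "\<sigma> 1 = \<one>"
    and scalar_central: "z \<in> carrier R \<Longrightarrow> z \<otimes> \<sigma> c = \<sigma> c \<otimes> z"

text \<open>The index is a ring with a central scalar map. At all other indices the value is pinned
  to \<open>undefined\<close>, so equality can be checked on the algebras alone.\<close>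

typedef (overloaded) ('f::field, 'c) alg_family =
  "{f :: 'c ring \<times> ('f \<Rightarrow> 'c) \<Rightarrow> 'c.
     \<forall>R \<sigma>. if central_algebra R \<sigma> then f (R, \<sigma>) \<in> carrier R else f (R, \<sigma>) = undefined}"
  by (rule exI[of _ "\<lambda>(R, \<sigma>). if central_algebra R \<sigma> then \<zero>\<^bsub>R\<^esub> else undefined"])
    (auto simp: central_algebra_def ring.ring_simprules)

setup_lifting type_definition_alg_family

lemma central_algebra_ring: "central_algebra R \<sigma> \<Longrightarrow> ring R"
  by (simp add: central_algebra_def)

instantiation alg_family :: (field, type) ab_group_add
begin

lift_definition zero_alg_family :: "('a, 'b) alg_family" is
  "\<lambda>(R, \<sigma>). if central_algebra R \<sigma> then \<zero>\<^bsub>R\<^esub> else undefined"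
  by (auto dest: central_algebra_ring intro: ring.ring_simprules)

lift_definition plus_alg_family :: "('a, 'b) alg_family \<Rightarrow> ('a, 'b) alg_family \<Rightarrow> ('a, 'b) alg_family" is
  "\<lambda>f g (R, \<sigma>). if central_algebra R \<sigma> then f (R, \<sigma>) \<oplus>\<^bsub>R\<^esub> g (R, \<sigma>) else undefined"
  by (auto dest: central_algebra_ring intro: ring.ring_simprules)

lift_definition uminus_alg_family :: "('a, 'b) alg_family \<Rightarrow> ('a, 'b) alg_family" is
  "\<lambda>f (R, \<sigma>). if central_algebra R \<sigma> then \<ominus>\<^bsub>R\<^esub> f (R, \<sigma>) else undefined"
  by (auto dest: central_algebra_ring intro: ring.ring_simprules)

lift_definition minus_alg_family :: "('a, 'b) alg_family \<Rightarrow> ('a, 'b) alg_family \<Rightarrow> ('a, 'b) alg_family" is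
  "\<lambda>f g (R, \<sigma>). if central_algebra R \<sigma> then f (R, \<sigma>) \<ominus>\<^bsub>R\<^esub> g (R, \<sigma>) else undefined"
  by (auto dest: central_algebra_ring intro: ring.ring_simprules)

instance
proof
  fix a b c :: "('a, 'b) alg_family"
  show "a + b + c = a + (b + c)"
    by transfer (auto simp: fun_eq_iff dest: central_algebra_ring intro: ring.ring_simprules)
  show "a + b = b + a"
    by transfer (auto simp: fun_eq_iff dest: central_algebra_ring intro: ring.ring_simprules)
  show "0 + a = a"
    by transfer (force simp: fun_eq_iff dest: central_algebra_ring intro: ring.ring_simprules)
  show "- a + a = 0"
    by transfer (auto simp: fun_eq_iff dest: central_algebra_ring intro: ring.ring_simprules)
  show "a - b = a + - b"
    by transfer (auto simp: fun_eq_iff a_minus_def)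
qed

end

lift_definition fam_mult :: "('f::field, 'c) alg_family \<Rightarrow> ('f, 'c) alg_family \<Rightarrow> ('f, 'c) alg_family" is
  "\<lambda>f g (R, \<sigma>). if central_algebra R \<sigma> then f (R, \<sigma>) \<otimes>\<^bsub>R\<^esub> g (R, \<sigma>) else undefined"
  by (auto dest: central_algebra_ring intro: ring.ring_simprules)

lift_definition fam_scale :: "'f::field \<Rightarrow> ('f, 'c) alg_family \<Rightarrow> ('f, 'c) alg_family" is
  "\<lambda>c f (R, \<sigma>). if central_algebra R \<sigma> then \<sigma> c \<otimes>\<^bsub>R\<^esub> f (R, \<sigma>) else undefined"
  by (auto dest: central_algebra_ring intro: ring.ring_simprules central_algebra.scalar_closed)

lemma (in central_algebra) scalar_left_comm:
  "\<lbrakk>u \<in> carrier R; v \<in> carrier R\<rbrakk> \<Longrightarrow> u \<otimes> (\<sigma> c \<otimes> v) = \<sigma> c \<otimes> (u \<otimes> v)"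
  by (metis m_assoc scalar_central scalar_closed)

lemma (in central_algebra) scalar_zero: "\<sigma> c \<otimes> \<zero> = \<zero>"
  by (simp add: scalar_closed)

interpretation fam: nalg fam_scale fam_mult
proof
  fix u v w :: "('f::field, 'c) alg_family" and c d :: 'f
  show "fam_mult (fam_mult u v) w = fam_mult u (fam_mult v w)"
    by transfer (auto simp: fun_eq_iff dest: central_algebra_ring intro: ring.ring_simprules)
  show "fam_mult (u + v) w = fam_mult u w + fam_mult v w"
    by transfer (auto simp: fun_eq_iff dest: central_algebra_ring intro: ring.ring_simprules)
  show "fam_mult u (v + w) = fam_mult u v + fam_mult u w"
    by transfer (auto simp: fun_eq_iff dest: central_algebra_ring intro: ring.ring_simprules)
  show "fam_mult (fam_scale c u) v = fam_scale c (fam_mult u v)"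
    by transfer (auto simp: fun_eq_iff dest: central_algebra_ring intro: ring.ring_simprules central_algebra.scalar_closed)
  show "fam_mult u (fam_scale c v) = fam_scale c (fam_mult u v)"
    by transfer (auto simp: fun_eq_iff intro: central_algebra.scalar_left_comm)
  show "fam_scale c (u + v) = fam_scale c u + fam_scale c v"
    by transfer (auto simp: fun_eq_iff dest: central_algebra_ring intro: ring.ring_simprules central_algebra.scalar_closed)
  show "fam_scale (c + d) u = fam_scale c u + fam_scale d u"
    by transfer (auto simp: fun_eq_iff central_algebra.scalar_add central_algebra.scalar_closed dest: central_algebra_ring
        intro: ring.ring_simprules(13))
  show "fam_scale c (fam_scale d u) = fam_scale (c * d) u"
    by transfer (auto simp: fun_eq_iff central_algebra.scalar_mult central_algebra.scalar_closed dest: central_algebra_ring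
        intro: ring.ring_simprules(11)[symmetric])
  show "fam_scale 1 u = u"
    by transfer (force simp: fun_eq_iff central_algebra.scalar_one dest: central_algebra_ring intro: ring.ring_simprules)
qed

text \<open>The element sits in its own component and zeros fill the others. Sums, products and
  scalar multiples are preserved, but the unit becomes a mere idempotent.\<close>

lift_definition fam_embed :: "'c ring \<Rightarrow> ('f::field \<Rightarrow> 'c) \<Rightarrow> 'c \<Rightarrow> ('f, 'c) alg_family" is
  "\<lambda>R0 \<sigma>0 z (R, \<sigma>). if central_algebra R \<sigma> then if R = R0 \<and> \<sigma> = \<sigma>0 \<and> z \<in> carrier R0 then z else \<zero>\<^bsub>R\<^esub> else undefined"
  by (auto dest: central_algebra_ring intro: ring.ring_simprules)

context central_algebra
begin

abbreviation embed where "embed \<equiv> fam_embed R \<sigma>"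

lemma embed_zero: "embed \<zero> = 0"
  by transfer (auto simp: fun_eq_iff)

lemma embed_add: "\<lbrakk>u \<in> carrier R; v \<in> carrier R\<rbrakk> \<Longrightarrow> embed (u \<oplus> v) = embed u + embed v"
  by transfer (auto simp: fun_eq_iff dest: central_algebra_ring intro: ring.ring_simprules(8)[symmetric] ring.ring_simprules)

lemma embed_inj: "inj_on embed (carrier R)"
proof (rule inj_on_inverseI)
  have "central_algebra R \<sigma>"
    by unfold_locales
  then show "Rep_alg_family (embed u) (R, \<sigma>) = u" if "u \<in> carrier R" for u
    using that by (simp add: fam_embed.rep_eq)
qed

lemma embed_mult: "\<lbrakk>u \<in> carrier R; v \<in> carrier R\<rbrakk> \<Longrightarrow> embed (u \<otimes> v) = fam_mult (embed u) (embed v)"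
  by transfer (auto simp: fun_eq_iff dest: central_algebra_ring intro: ring.ring_simprules(24)[symmetric] ring.ring_simprules)

lemma embed_scale: "u \<in> carrier R \<Longrightarrow> embed (\<sigma> c \<otimes> u) = fam_scale c (embed u)"
proof (rule Rep_alg_family_inject[THEN iffD1], rule ext, clarify)
  fix R' :: "'c ring" and \<sigma>' :: "'f \<Rightarrow> 'c"
  assume u: "u \<in> carrier R"
  have "\<sigma>' c \<otimes>\<^bsub>R'\<^esub> \<zero>\<^bsub>R'\<^esub> = \<zero>\<^bsub>R'\<^esub>" if "central_algebra R' \<sigma>'"
    by (rule central_algebra.scalar_zero[OF that])
  then show "Rep_alg_family (embed (\<sigma> c \<otimes> u)) (R', \<sigma>') = Rep_alg_family (fam_scale c (embed u)) (R', \<sigma>')"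
    using u scalar_closed[of c] by (auto simp: fam_embed.rep_eq fam_scale.rep_eq)
qed

lemma embed_minus: "u \<in> carrier R \<Longrightarrow> embed (\<ominus> u) = - embed u"
  using embed_add[of u "\<ominus> u"] by (simp add: embed_zero r_neg eq_neg_iff_add_eq_0 add.commute)

lemma embed_diff: "\<lbrakk>u \<in> carrier R; v \<in> carrier R\<rbrakk> \<Longrightarrow> embed (u \<ominus> v) = embed u - embed v"
  by (simp add: a_minus_def embed_add embed_minus)

lemma embed_eq_0_iff: "u \<in> carrier R \<Longrightarrow> embed u = 0 \<longleftrightarrow> u = \<zero>"
  using embed_inj by (metis embed_zero inj_on_eq_iff zero_closed)

text \<open>Elements built by calculations inside this copy of the algebra can be pulled back to
  it.\<close>

definition embed_range :: "('f, 'c) alg_family set" where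
  "embed_range = embed ` carrier R"

lemma embed_range_closed:
  "0 \<in> embed_range"
  "\<lbrakk>u \<in> embed_range; v \<in> embed_range\<rbrakk> \<Longrightarrow> u + v \<in> embed_range"
  "\<lbrakk>u \<in> embed_range; v \<in> embed_range\<rbrakk> \<Longrightarrow> u - v \<in> embed_range"
  "\<lbrakk>u \<in> embed_range; v \<in> embed_range\<rbrakk> \<Longrightarrow> fam_mult u v \<in> embed_range"
  "u \<in> embed_range \<Longrightarrow> fam_scale c u \<in> embed_range"
  unfolding embed_range_def
  by (auto simp flip: embed_zero embed_add embed_diff embed_mult embed_scale simp: scalar_closed)

end

section \<open>Free algebras and their quotients\<close>

lemma fa_mult_splits: "fa_mult p r w = (\<Sum>y | fst y @ snd y = w. p (fst y) * r (snd y))"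
  unfolding fa_mult_def
  by (rule sum.reindex_bij_witness[of _ "\<lambda>y. length (fst y)" "\<lambda>i. (take i w, drop i w)"]) auto

lemma finite_splits [simp]: "finite {y. fst y @ snd y = w}"
proof (rule finite_subset)
  show "{y. fst y @ snd y = w} \<subseteq> (\<lambda>i. (take i w, drop i w)) ` {..length w}"
  proof clarify
    fix u v
    show "(u, v) \<in> (\<lambda>i. (take i (fst (u, v) @ snd (u, v)), drop i (fst (u, v) @ snd (u, v)))) `
        {..length (fst (u, v) @ snd (u, v))}"
      by (rule image_eqI[of _ _ "length u"]) auto
  qed
qed simp

lemma fa_mult_assoc: "fa_mult (fa_mult p r) z = fa_mult p (fa_mult r z)"
proof
  fix w
  have "fa_mult (fa_mult p r) z w =
      (\<Sum>y | fst y @ snd y = w. \<Sum>s | fst s @ snd s = fst y. p (fst s) * r (snd s) * z (snd y))"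
    by (simp add: fa_mult_splits sum_distrib_right)
  also have "\<dots> = (\<Sum>(y, s)\<in>Sigma {y. fst y @ snd y = w} (\<lambda>y. {s. fst s @ snd s = fst y}).
      p (fst s) * r (snd s) * z (snd y))"
    by (rule sum.Sigma) auto
  \<comment> \<open>Both index sets describe the factorisations of \<open>w\<close> into three
    words, bracketed to the left and to the right.\<close>
  also have "\<dots> = (\<Sum>(y, s)\<in>Sigma {y. fst y @ snd y = w} (\<lambda>y. {s. fst s @ snd s = snd y}).
      p (fst y) * (r (fst s) * z (snd s)))"
    by (rule sum.reindex_bij_witness[of _ "\<lambda>((s, m), (t, v)). ((s @ t, v), (s, t))" "\<lambda>((u, v), (s, t)). ((s, t @ v), (t, v))"])
      (auto simp: mult.assoc)
  also have "\<dots> = (\<Sum>y | fst y @ snd y = w. \<Sum>s | fst s @ snd s = snd y. p (fst y) * (r (fst s) * z (snd s)))"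
    by (rule sum.Sigma[symmetric]) auto
  also have "\<dots> = fa_mult p (fa_mult r z) w"
    by (simp add: fa_mult_splits sum_distrib_left)
  finally show "fa_mult (fa_mult p r) z w = fa_mult p (fa_mult r z) w" .
qed

lemma fa_mult_support: "{w. fa_mult p r w \<noteq> 0} \<subseteq> (\<lambda>y. fst y @ snd y) ` ({w. p w \<noteq> 0} \<times> {w. r w \<noteq> 0})"
proof
  fix w
  assume "w \<in> {w. fa_mult p r w \<noteq> 0}"
  then obtain y where "fst y @ snd y = w" "p (fst y) * r (snd y) \<noteq> 0"
    unfolding fa_mult_splits by (auto elim: sum.not_neutral_contains_not_neutral)
  then show "w \<in> (\<lambda>y. fst y @ snd y) ` ({w. p w \<noteq> 0} \<times> {w. r w \<noteq> 0})"
    by (intro image_eqI[of _ _ y]) (auto simp: mem_Times_iff)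
qed

lemma fa_mult_scal_left: "fa_mult (fa_scal c) p = fa_smult c p"
proof
  fix w
  have "fa_mult (fa_scal c) p w = (\<Sum>i\<le>length w. if i = 0 then c * p w else 0)"
    unfolding fa_mult_def fa_scal_def by (intro sum.cong) auto
  then show "fa_mult (fa_scal c) p w = fa_smult c p w"
    by (simp add: fa_smult_def)
qed

lemma fa_mult_scal_right: "fa_mult p (fa_scal c) = fa_smult c p"
proof
  fix w
  have "fa_mult p (fa_scal c) w = (\<Sum>i\<le>length w. if i = length w then c * p w else 0)"
    unfolding fa_mult_def fa_scal_def by (intro sum.cong) auto
  then show "fa_mult p (fa_scal c) w = fa_smult c p w"
    by (simp add: fa_smult_def)
qed

lemma fa_carrier_iff: "p \<in> carrier free_alg \<longleftrightarrow> finite {w. p w \<noteq> 0}"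
  by (simp add: free_alg_def)

lemma free_alg_ops:
  "p \<oplus>\<^bsub>free_alg\<^esub> r = fa_add p r" "p \<otimes>\<^bsub>free_alg\<^esub> r = fa_mult p r"
  "\<one>\<^bsub>free_alg\<^esub> = fa_scal 1" "\<zero>\<^bsub>free_alg\<^esub> = (\<lambda>w. 0)"
  by (simp_all add: free_alg_def fa_add_def)

lemma fa_closed [simp, intro]:
  "fa_scal c \<in> carrier free_alg" "fa_var x \<in> carrier free_alg"
  "\<lbrakk>p \<in> carrier free_alg; r \<in> carrier free_alg\<rbrakk> \<Longrightarrow> fa_add p r \<in> carrier free_alg"
  "\<lbrakk>p \<in> carrier free_alg; r \<in> carrier free_alg\<rbrakk> \<Longrightarrow> fa_sub p r \<in> carrier free_alg"
  "\<lbrakk>p \<in> carrier free_alg; r \<in> carrier free_alg\<rbrakk> \<Longrightarrow> fa_mult p r \<in> carrier free_alg"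
  "p \<in> carrier free_alg \<Longrightarrow> fa_smult c p \<in> carrier free_alg"
proof -
  show "fa_scal c \<in> carrier free_alg"
    unfolding fa_carrier_iff by (rule finite_subset[of _ "{[]}"]) (auto simp: fa_scal_def)
  show "fa_var x \<in> carrier free_alg"
    unfolding fa_carrier_iff by (rule finite_subset[of _ "{[x]}"]) (auto simp: fa_var_def)
  assume p: "p \<in> carrier free_alg"
  then show "fa_smult c p \<in> carrier free_alg"
    unfolding fa_carrier_iff by (rule rev_finite_subset) (auto simp: fa_smult_def)
  assume r: "r \<in> carrier free_alg"
  have pr: "finite ({w. p w \<noteq> 0} \<union> {w. r w \<noteq> 0})"
    using p r unfolding fa_carrier_iff by simp
  show "fa_add p r \<in> carrier free_alg"
    unfolding fa_carrier_iff by (rule finite_subset[OF _ pr]) (auto simp: fa_add_def)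
  show "fa_sub p r \<in> carrier free_alg"
    unfolding fa_carrier_iff by (rule finite_subset[OF _ pr]) (auto simp: fa_sub_def)
  show "fa_mult p r \<in> carrier free_alg"
    unfolding fa_carrier_iff
    by (rule finite_subset[OF fa_mult_support]) (use p r in \<open>auto simp: fa_carrier_iff\<close>)
qed

lemma fa_closed_brackets [simp, intro]:
  "\<lbrakk>p \<in> carrier free_alg; r \<in> carrier free_alg\<rbrakk> \<Longrightarrow> fa_comm p r \<in> carrier free_alg"
  "\<lbrakk>p \<in> carrier free_alg; r \<in> carrier free_alg\<rbrakk> \<Longrightarrow> fa_qcomm q p r \<in> carrier free_alg"
  by (simp_all add: fa_comm_def fa_qcomm_def)

lemma free_alg_ring: "ring (free_alg :: ('x list \<Rightarrow> 'f::field) ring)"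
proof (rule ringI)
  show "abelian_group (free_alg :: ('x list \<Rightarrow> 'f::field) ring)"
  proof (rule abelian_groupI)
    show "\<zero>\<^bsub>free_alg\<^esub> \<in> carrier (free_alg :: ('x list \<Rightarrow> 'f::field) ring)"
      by (simp add: free_alg_ops fa_carrier_iff)
  next
    fix p :: "'x list \<Rightarrow> 'f" assume "p \<in> carrier free_alg"
    then have "fa_smult (- 1) p \<in> carrier free_alg"
      by simp
    then show "\<exists>r\<in>carrier free_alg. r \<oplus>\<^bsub>free_alg\<^esub> p = \<zero>\<^bsub>free_alg\<^esub>"
      by (rule bexI[rotated]) (auto simp: free_alg_ops fa_add_def fa_smult_def)
  qed (simp_all add: free_alg_ops, simp_all add: fa_add_def algebra_simps)
  show "monoid (free_alg :: ('x list \<Rightarrow> 'f::field) ring)"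
    by (rule monoidI) (auto simp: free_alg_ops fa_mult_assoc fa_mult_scal_left fa_mult_scal_right, simp_all add: fa_smult_def)
qed (simp_all add: free_alg_ops, simp_all add: fa_add_def fa_mult_def fun_eq_iff distrib_left distrib_right sum.distrib)

lemma free_alg_minus:
  assumes "p \<in> carrier free_alg" "r \<in> carrier free_alg"
  shows "p \<ominus>\<^bsub>free_alg\<^esub> r = fa_sub p r"
proof -
  interpret ring free_alg
    by (rule free_alg_ring)
  have "fa_sub p r \<oplus>\<^bsub>free_alg\<^esub> r = p"
    by (simp add: free_alg_ops fa_sub_def fa_add_def)
  moreover have "(p \<ominus>\<^bsub>free_alg\<^esub> r) \<oplus>\<^bsub>free_alg\<^esub> r = p"
    using assms by (simp add: a_minus_def a_assoc l_neg)
  ultimately show ?thesis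
    using assms add.right_cancel[of r "p \<ominus>\<^bsub>free_alg\<^esub> r" "fa_sub p r"] by simp
qed

text \<open>Monomials arise from constants by multiplying with variables; a polynomial is a sum of
  monomials, peeled off its support one word at a time.\<close>

lemma fa_induct [consumes 1, case_names scal var add mult]:
  assumes p: "p \<in> carrier free_alg"
    and scal: "\<And>c. P (fa_scal c)" and var: "\<And>x. P (fa_var x)"
    and add: "\<And>p r. \<lbrakk>p \<in> carrier free_alg; r \<in> carrier free_alg; P p; P r\<rbrakk> \<Longrightarrow> P (fa_add p r)"
    and mult: "\<And>p r. \<lbrakk>p \<in> carrier free_alg; r \<in> carrier free_alg; P p; P r\<rbrakk> \<Longrightarrow> P (fa_mult p r)"
  shows "P p"
proof -
  define mono :: "'b \<Rightarrow> 'a list \<Rightarrow> 'a list \<Rightarrow> 'b" where "mono c w = (\<lambda>u. if u = w then c else 0)" for c w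
  have mono: "mono c w \<in> carrier free_alg \<and> P (mono c w)" for c w
  proof (induction w)
    case Nil
    have "mono c [] = fa_scal c"
      by (simp add: mono_def fa_scal_def)
    then show ?case
      using scal by simp
  next
    case (Cons x w)
    have "mono c (x # w) = fa_mult (fa_var x) (mono c w)"
    proof
      fix u
      have "fa_mult (fa_var x) (mono c w) u = (\<Sum>y | fst y @ snd y = u. if y = ([x], w) then c else 0)"
        unfolding fa_mult_splits fa_var_def mono_def by (intro sum.cong) (auto simp: prod_eq_iff)
      then show "mono c (x # w) u = fa_mult (fa_var x) (mono c w) u"
        by (auto simp: mono_def)
    qed
    then show ?case
      using Cons var mult by simp
  qed
  have "p \<in> carrier free_alg \<and> P p" if "finite A" "{w. p w \<noteq> 0} \<subseteq> A" for A p
    using that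
  proof (induction A arbitrary: p rule: finite_induct)
    case empty
    then have "p = fa_scal 0"
      by (auto simp: fa_scal_def)
    then show ?case
      using scal by simp
  next
    case (insert w A)
    have "p(w := 0) \<in> carrier free_alg \<and> P (p(w := 0))"
      using insert.prems by (intro insert.IH) auto
    moreover have "p = fa_add (p(w := 0)) (mono (p w) w)"
      by (auto simp: fa_add_def mono_def)
    ultimately show ?case
      using mono add fa_closed(3) by metis
  qed
  then show ?thesis
    using p by (auto simp: fa_carrier_iff)
qed

section \<open>Evaluation and homomorphisms out of the free algebra\<close>

locale nalg_eval = nalg sc mul
  for sc :: "'f::field \<Rightarrow> 'a::ab_group_add \<Rightarrow> 'a" and mul :: "'a \<Rightarrow> 'a \<Rightarrow> 'a" (infixl "\<cdot>" 70) +
  fixes e :: 'a and v :: "'x \<Rightarrow> 'a"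
  assumes e_e: "e \<cdot> e = e" and e_v: "e \<cdot> v x = v x" and v_e: "v x \<cdot> e = v x"
begin

text \<open>The empty word goes to the idempotent \<open>e\<close>, a unit only for the values
  \<open>v x\<close>.\<close>

primrec word :: "'x list \<Rightarrow> 'a" where
  "word [] = e"
| "word (x # w) = v x \<cdot> word w"

lemma e_word: "e \<cdot> word w = word w"
  by (cases w) (simp_all add: e_e e_v flip: mul_assoc)

lemma word_append: "word (u @ w) = word u \<cdot> word w"
  by (induction u) (simp_all add: e_word mul_assoc)

definition eval :: "('x list \<Rightarrow> 'f) \<Rightarrow> 'a" where
  "eval p = (\<Sum>w | p w \<noteq> 0. sc (p w) (word w))"

lemma eval_superset:
  assumes "finite A" "{w. p w \<noteq> 0} \<subseteq> A"
  shows "eval p = (\<Sum>w\<in>A. sc (p w) (word w))"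
  unfolding eval_def using assms by (intro sum.mono_neutral_left) auto

lemma eval_scal: "eval (fa_scal c) = sc c e"
proof -
  have "{w. fa_scal c w \<noteq> 0} \<subseteq> {[]}"
    by (auto simp: fa_scal_def)
  then show ?thesis
    using eval_superset[of "{[]}" "fa_scal c"] by (simp add: fa_scal_def)
qed

lemma eval_var: "eval (fa_var x) = v x"
proof -
  have "{w. (fa_var x :: 'x list \<Rightarrow> 'f) w \<noteq> 0} \<subseteq> {[x]}"
    by (auto simp: fa_var_def)
  then show ?thesis
    using eval_superset[of "{[x]}" "fa_var x"] by (simp add: fa_var_def v_e sc_one)
qed

lemma eval_add:
  assumes "p \<in> carrier free_alg" "r \<in> carrier free_alg"
  shows "eval (fa_add p r) = eval p + eval r"
proof -
  let ?A = "{w. p w \<noteq> 0} \<union> {w. r w \<noteq> 0}"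
  have "finite ?A"
    using assms by (simp add: fa_carrier_iff)
  moreover have "{w. fa_add p r w \<noteq> 0} \<subseteq> ?A"
    by (auto simp: fa_add_def)
  ultimately show ?thesis
    using eval_superset[of ?A p] eval_superset[of ?A r] eval_superset[of ?A "fa_add p r"]
    by (simp add: fa_add_def sc_add_left sum.distrib)
qed

lemma eval_mult:
  assumes "p \<in> carrier free_alg" "r \<in> carrier free_alg"
  shows "eval (fa_mult p r) = eval p \<cdot> eval r"
proof -
  let ?P = "{w. p w \<noteq> 0}" and ?Q = "{w. r w \<noteq> 0}"
  let ?W = "(\<lambda>y. fst y @ snd y) ` (?P \<times> ?Q)"
  let ?f = "\<lambda>y. sc (p (fst y) * r (snd y)) (word (fst y) \<cdot> word (snd y))"
  let ?S = "Sigma ?W (\<lambda>w. {y. fst y @ snd y = w})"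
  have fin: "finite ?P" "finite ?Q" "finite ?W"
    using assms by (auto simp: fa_carrier_iff)
  have "eval (fa_mult p r) = (\<Sum>w\<in>?W. \<Sum>y | fst y @ snd y = w. ?f y)"
    unfolding eval_superset[OF fin(3) fa_mult_support] fa_mult_splits sc_sum
    by (intro sum.cong refl) (auto simp flip: word_append)
  also have "\<dots> = (\<Sum>(w, y)\<in>?S. ?f y)"
    using fin(3) by (intro sum.Sigma) auto
  \<comment> \<open>Factorisations with a factor outside the supports contribute zero.\<close>
  also have "\<dots> = (\<Sum>(w, y)\<in>(\<lambda>y. (fst y @ snd y, y)) ` (?P \<times> ?Q). ?f y)"
  proof (rule sum.mono_neutral_right)
    show "finite ?S"
      using fin(3) by (intro finite_SigmaI) simp_all
    show "\<forall>i\<in>?S - (\<lambda>y. (fst y @ snd y, y)) ` (?P \<times> ?Q). (case i of (w, y) \<Rightarrow> ?f y) = 0"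
    proof
      fix i
      assume i: "i \<in> ?S - (\<lambda>y. (fst y @ snd y, y)) ` (?P \<times> ?Q)"
      then have i_eq: "i = (\<lambda>y. (fst y @ snd y, y)) (snd i)"
        by auto
      have "snd i \<notin> ?P \<times> ?Q"
      proof
        assume "snd i \<in> ?P \<times> ?Q"
        with i_eq have "i \<in> (\<lambda>y. (fst y @ snd y, y)) ` (?P \<times> ?Q)"
          by (rule image_eqI)
        then show False
          by (rule DiffD2[OF i])
      qed
      then show "(case i of (w, y) \<Rightarrow> ?f y) = 0"
        by (auto simp: mem_Times_iff split_def)
    qed
  qed auto
  also have "\<dots> = (\<Sum>y\<in>?P \<times> ?Q. ?f y)"
    by (subst sum.reindex) (auto simp: inj_on_def)
  also have "\<dots> = (\<Sum>u\<in>?P. \<Sum>v\<in>?Q. sc (p u) (word u) \<cdot> sc (r v) (word v))"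
    by (simp add: sum.cartesian_product sc_mul_left sc_mul_right sc_sc split_def mult.commute)
  also have "\<dots> = eval p \<cdot> eval r"
    unfolding eval_def mul_sum_left by (simp only: mul_sum_right)
  finally show ?thesis .
qed

end

text \<open>Fixing the images of the constants makes a ring homomorphism linear over the
  field.\<close>

locale free_alg_hom = central_algebra R \<sigma> for R :: "'c ring" (structure) and \<sigma> :: "'f::field \<Rightarrow> 'c" +
  fixes \<psi> :: "('x list \<Rightarrow> 'f) \<Rightarrow> 'c"
  assumes hom: "\<psi> \<in> ring_hom free_alg R"
    and hom_scal: "\<psi> (fa_scal c) = \<sigma> c"
begin

lemma hom_closed [simp]: "p \<in> carrier free_alg \<Longrightarrow> \<psi> p \<in> carrier R"
  using hom by (rule ring_hom_closed)

definition emb :: "('x list \<Rightarrow> 'f) \<Rightarrow> ('f, 'c) alg_family" where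
  "emb p = embed (\<psi> p)"

lemma emb_add: "\<lbrakk>p \<in> carrier free_alg; s \<in> carrier free_alg\<rbrakk> \<Longrightarrow> emb (fa_add p s) = emb p + emb s"
  using ring_hom_add[OF hom, of p s] by (simp add: emb_def embed_add free_alg_ops)

lemma emb_mult: "\<lbrakk>p \<in> carrier free_alg; s \<in> carrier free_alg\<rbrakk> \<Longrightarrow> emb (fa_mult p s) = fam_mult (emb p) (emb s)"
  using ring_hom_mult[OF hom, of p s] by (simp add: emb_def embed_mult free_alg_ops)

lemma emb_smult: "p \<in> carrier free_alg \<Longrightarrow> emb (fa_smult c p) = fam_scale c (emb p)"
  using ring_hom_mult[OF hom, of "fa_scal c" p]
  by (simp add: emb_def embed_scale free_alg_ops fa_mult_scal_left hom_scal)

lemma emb_sub: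
  assumes "p \<in> carrier free_alg" "s \<in> carrier free_alg"
  shows "emb (fa_sub p s) = emb p - emb s"
proof -
  have "fa_sub p s = fa_add p (fa_smult (- 1) s)"
    by (simp add: fa_sub_def fa_add_def fa_smult_def)
  then show ?thesis
    using assms by (simp add: emb_add emb_smult fam.sc_minus_left fam.sc_one)
qed

lemma emb_comm: "\<lbrakk>p \<in> carrier free_alg; s \<in> carrier free_alg\<rbrakk> \<Longrightarrow> emb (fa_comm p s) = fam.cm (emb p) (emb s)"
  by (simp add: fa_comm_def emb_sub emb_mult fam.cm_def)

lemma emb_qcomm:
  "\<lbrakk>p \<in> carrier free_alg; s \<in> carrier free_alg\<rbrakk> \<Longrightarrow>
    emb (fa_qcomm c p s) = fam_scale c (fam_mult (emb p) (emb s)) - fam_scale (inverse c) (fam_mult (emb s) (emb p))"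
  by (simp add: fa_qcomm_def emb_sub emb_smult emb_mult)

lemma emb_eq_0_iff: "p \<in> carrier free_alg \<Longrightarrow> emb p = 0 \<longleftrightarrow> \<psi> p = \<zero>"
  by (simp add: emb_def embed_eq_0_iff)

lemma hom_eqI:
  assumes "free_alg_hom R \<sigma> \<psi>'" and "\<And>x. \<psi>' (fa_var x) = \<psi> (fa_var x)" and "p \<in> carrier free_alg"
  shows "\<psi>' p = \<psi> p"
proof -
  interpret other: free_alg_hom R \<sigma> \<psi>'
    by fact
  show ?thesis
    using assms(3)
  proof (induction p rule: fa_induct)
    case (add p s)
    then show ?case
      using ring_hom_add[OF hom, of p s] ring_hom_add[OF other.hom, of p s] by (simp add: free_alg_ops)
  next
    case (mult p s)
    then show ?case
      using ring_hom_mult[OF hom, of p s] ring_hom_mult[OF other.hom, of p s] by (simp add: free_alg_ops)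
  qed (simp_all add: assms hom_scal other.hom_scal)
qed

end

text \<open>Evaluation takes place in the product of all algebras. Its values stay in the copy of
  \<open>R\<close>, and injectivity of the embedding pulls them back.\<close>

lemma (in central_algebra) free_alg_hom_exists:
  assumes v: "\<And>x. v x \<in> carrier R"
  shows "\<exists>\<psi>. free_alg_hom R \<sigma> \<psi> \<and> (\<forall>x. \<psi> (fa_var x) = v x)"
proof -
  interpret nalg_eval fam_scale fam_mult "embed \<one>" "\<lambda>x. embed (v x)"
    by unfold_locales (simp_all add: v flip: embed_mult)
  have "embed \<one> \<in> embed_range" "embed (v x) \<in> embed_range" for x
    by (simp_all add: v embed_range_def)
  then have word_image: "word w \<in> embed_range" for w
    by (induction w) (simp_all add: embed_range_closed(4))
  have "eval p \<in> embed_range" for p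
  proof -
    have "(\<Sum>w\<in>A. fam_scale (p w) (word w)) \<in> embed_range" for A
      by (induction A rule: infinite_finite_induct) (auto simp: embed_range_closed word_image)
    then show ?thesis
      by (simp add: eval_def)
  qed
  then have "\<forall>p. \<exists>u\<in>carrier R. eval p = embed u"
    by (simp add: embed_range_def image_iff)
  then obtain \<psi> where \<psi>: "\<And>p. \<psi> p \<in> carrier R" "\<And>p. embed (\<psi> p) = eval p"
    by metis
  have eq: "\<psi> p = u" if "u \<in> carrier R" "embed u = eval p" for p u
    using that \<psi> embed_inj by (metis inj_onD)
  have scal: "\<psi> (fa_scal c) = \<sigma> c" for c
    using scalar_closed[of c] embed_scale[of \<one> c] by (intro eq) (simp_all add: eval_scal)
  have "\<psi> \<in> ring_hom free_alg R"
  proof (rule ring_hom_memI)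
    show "\<psi> \<one>\<^bsub>free_alg\<^esub> = \<one>"
      by (simp add: free_alg_ops scal scalar_one)
  qed (auto intro!: eq \<psi> simp: free_alg_ops eval_add eval_mult embed_add embed_mult \<psi>)
  then have "free_alg_hom R \<sigma> \<psi>"
    by unfold_locales (simp_all add: scal)
  moreover have "\<psi> (fa_var x) = v x" for x
    by (intro eq) (simp_all add: v eval_var)
  ultimately show ?thesis
    by blast
qed

section \<open>Quotients of the free algebra and their universal property\<close>

definition quot_scal :: "('x list \<Rightarrow> 'f::field) set \<Rightarrow> 'f \<Rightarrow> ('x list \<Rightarrow> 'f) set" where
  "quot_scal I c = I +>\<^bsub>free_alg\<^esub> fa_scal c"

lemma quot_hom:
  assumes "ideal I (free_alg :: ('x list \<Rightarrow> 'f::field) ring)"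
  shows "free_alg_hom (free_alg Quot I) (quot_scal I) (a_r_coset free_alg I)"
proof -
  interpret ideal I "free_alg :: ('x list \<Rightarrow> 'f) ring"
    by fact
  interpret Q: ring "free_alg Quot I"
    by (rule quotient_is_ring)
  note h = rcos_ring_hom
  show ?thesis
  proof unfold_locales
    fix c d :: 'f
    show "quot_scal I c \<in> carrier (free_alg Quot I)"
      unfolding quot_scal_def using h by (rule ring_hom_closed) simp
    show "quot_scal I (c + d) = quot_scal I c \<oplus>\<^bsub>free_alg Quot I\<^esub> quot_scal I d"
    proof -
      have "fa_scal (c + d) = fa_scal c \<oplus>\<^bsub>free_alg\<^esub> (fa_scal d :: 'x list \<Rightarrow> 'f)"
        by (simp add: free_alg_ops fa_add_def fa_scal_def fun_eq_iff)
      then show ?thesis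
        by (simp add: quot_scal_def ring_hom_add[OF h])
    qed
    show "quot_scal I (c * d) = quot_scal I c \<otimes>\<^bsub>free_alg Quot I\<^esub> quot_scal I d"
    proof -
      have "fa_scal (c * d) = fa_scal c \<otimes>\<^bsub>free_alg\<^esub> (fa_scal d :: 'x list \<Rightarrow> 'f)"
        by (simp add: free_alg_ops fa_mult_scal_left) (simp add: fa_smult_def fa_scal_def fun_eq_iff)
      then show ?thesis
        by (simp add: quot_scal_def ring_hom_mult[OF h])
    qed
    show "quot_scal I 1 = \<one>\<^bsub>free_alg Quot I\<^esub>"
      using ring_hom_one[OF h] by (simp add: quot_scal_def free_alg_ops)
    show "z \<otimes>\<^bsub>free_alg Quot I\<^esub> quot_scal I c = quot_scal I c \<otimes>\<^bsub>free_alg Quot I\<^esub> z"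
      if z: "z \<in> carrier (free_alg Quot I)" for z
    proof -
      obtain p where p: "p \<in> carrier free_alg" "z = I +>\<^bsub>free_alg\<^esub> p"
        using z by (auto simp: FactRing_def A_RCOSETS_def')
      have "p \<otimes>\<^bsub>free_alg\<^esub> fa_scal c = fa_scal c \<otimes>\<^bsub>free_alg\<^esub> p"
        by (simp add: free_alg_ops fa_mult_scal_left fa_mult_scal_right)
      then show ?thesis
        using p by (simp add: quot_scal_def flip: ring_hom_mult[OF h])
    qed
  qed (simp_all add: h quot_scal_def)
qed

text \<open>The kernel is an ideal containing \<open>S\<close>, hence contains \<open>I\<close>, so
  the value on a coset does not depend on the representative.\<close>

lemma quot_lift:
  fixes \<psi> :: "('x list \<Rightarrow> 'f::field) \<Rightarrow> 'c"
  assumes "free_alg_hom R \<sigma> \<psi>" and S: "S \<subseteq> carrier free_alg" and kill: "\<And>s. s \<in> S \<Longrightarrow> \<psi> s = \<zero>\<^bsub>R\<^esub>"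
    and I: "I = genideal free_alg S"
  shows "\<exists>h\<in>ring_hom (free_alg Quot I) R. \<forall>p\<in>carrier free_alg. h (I +>\<^bsub>free_alg\<^esub> p) = \<psi> p"
proof -
  interpret free_alg_hom R \<sigma> \<psi>
    by (fact assms(1))
  interpret F: ring "free_alg :: ('x list \<Rightarrow> 'f) ring"
    by (rule free_alg_ring)
  interpret H: ring_hom_ring free_alg R \<psi>
    by (rule ring_hom_ringI2[OF F.ring_axioms ring_axioms hom])
  interpret I: ideal I free_alg
    unfolding I by (rule F.genideal_ideal[OF S])
  have "I \<subseteq> a_kernel free_alg R \<psi>"
    unfolding I
  proof (rule F.genideal_minimal[OF H.kernel_is_ideal])
    show "S \<subseteq> a_kernel free_alg R \<psi>"
      unfolding a_kernel_def' using S kill by blast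
  qed
  then have I0: "\<psi> p = \<zero>\<^bsub>R\<^esub>" if "p \<in> I" for p
    using that unfolding a_kernel_def' by blast
  define h where "h X = \<psi> (SOME p. p \<in> carrier free_alg \<and> X = I +>\<^bsub>free_alg\<^esub> p)" for X
  have h: "h (I +>\<^bsub>free_alg\<^esub> p) = \<psi> p" if p: "p \<in> carrier free_alg" for p
  proof -
    define s where "s = (SOME s. s \<in> carrier free_alg \<and> I +>\<^bsub>free_alg\<^esub> p = I +>\<^bsub>free_alg\<^esub> s)"
    have "s \<in> carrier free_alg \<and> I +>\<^bsub>free_alg\<^esub> p = I +>\<^bsub>free_alg\<^esub> s"
      unfolding s_def by (rule someI[of _ p]) (simp add: p)
    then have s: "s \<in> carrier free_alg" "s \<ominus>\<^bsub>free_alg\<^esub> p \<in> I"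
      using F.quotient_eq_iff_same_a_r_cos[OF I.is_ideal, of s p] p by auto
    then have "\<psi> (fa_sub s p) = \<zero>\<^bsub>R\<^esub>"
      using I0 p by (simp add: free_alg_minus)
    then have "embed (\<psi> s) = embed (\<psi> p)"
      using emb_sub[OF s(1) p] emb_eq_0_iff[of "fa_sub s p"] s p by (simp add: emb_def)
    then have "\<psi> s = \<psi> p"
      using embed_inj s p by (meson hom_closed inj_onD)
    then show ?thesis
      by (simp add: h_def s_def)
  qed
  note \<pi> = I.rcos_ring_hom
  have rep: "\<exists>p\<in>carrier free_alg. X = I +>\<^bsub>free_alg\<^esub> p" if "X \<in> carrier (free_alg Quot I)" for X
    using that by (auto simp: FactRing_def A_RCOSETS_def')
  have "h \<in> ring_hom (free_alg Quot I) R"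
  proof (rule ring_hom_memI)
    fix X Y
    assume X: "X \<in> carrier (free_alg Quot I)"
    then show "h X \<in> carrier R"
      using rep[OF X] h by force
    assume Y: "Y \<in> carrier (free_alg Quot I)"
    obtain p s where "p \<in> carrier free_alg" "s \<in> carrier free_alg"
        and "X = I +>\<^bsub>free_alg\<^esub> p" "Y = I +>\<^bsub>free_alg\<^esub> s"
      using rep[OF X] rep[OF Y] by blast
    then show "h (X \<otimes>\<^bsub>free_alg Quot I\<^esub> Y) = h X \<otimes>\<^bsub>R\<^esub> h Y" "h (X \<oplus>\<^bsub>free_alg Quot I\<^esub> Y) = h X \<oplus>\<^bsub>R\<^esub> h Y"
      by (simp_all add: h flip: ring_hom_mult[OF \<pi>] ring_hom_add[OF \<pi>])
  next
    show "h \<one>\<^bsub>free_alg Quot I\<^esub> = \<one>\<^bsub>R\<^esub>"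
      using h[OF F.one_closed] by (simp add: ring_hom_one[OF \<pi>])
  qed
  then show ?thesis
    using h by blast
qed

section \<open>The isomorphism\<close>

text \<open>\<open>ga\<close> and \<open>bg\<close> determine \<open>x\<close> and \<open>y\<close>
  recursively from their first terms and \<open>g\<close>; \<open>ay\<close> then determines
  \<open>G\<close>.\<close>

lemma alternating_unique:
  assumes "alternating sc mul q p r x y G g" and "alternating sc mul q p r x' y' G' g"
    and eq0: "x 0 = x' 0" "y 0 = y' 0" and r0: "r \<noteq> 0" and nz: "q + p \<noteq> 0"
  shows "x k = x' k \<and> y k = y' k \<and> G k = G' k"
proof -
  interpret A: alternating sc mul q p r x y G g
    by fact
  interpret B: alternating sc mul q p r x' y' G' g
    by fact
  have xy: "x k = x' k \<and> y k = y' k" for k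
  proof (induction k)
    case (Suc k)
    have "sc r (x (Suc k)) = sc r (x' (Suc k))" "sc r (y (Suc k)) = sc r (y' (Suc k))"
      using A.ga[of k] B.ga[of k] A.bg[of k] B.bg[of k] Suc eq0 by simp_all
    then show ?case
      using r0 by (simp add: A.sc_cancel)
  qed (simp add: eq0)
  have "sc (inverse (q + p)) (g k - G k) = sc (inverse (q + p)) (g k - G' k)"
    using A.ay[of k] B.ay[of k] xy eq0 by simp
  then have "G k = G' k"
    using nz by (simp add: A.sc_cancel)
  then show ?thesis
    using xy by simp
qed

text \<open>With \<open>A\<close> the copy of \<open>Oqv q\<close> in the product, this shows that
  the recursively built elements come from \<open>Oqv q\<close>.\<close>

lemma (in compact) xy_closed:
  assumes add: "\<And>u v. \<lbrakk>u \<in> A; v \<in> A\<rbrakk> \<Longrightarrow> u + v \<in> A" and diff: "\<And>u v. \<lbrakk>u \<in> A; v \<in> A\<rbrakk> \<Longrightarrow> u - v \<in> A"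
    and mul: "\<And>u v. \<lbrakk>u \<in> A; v \<in> A\<rbrakk> \<Longrightarrow> u \<cdot> v \<in> A" and sc: "\<And>c u. u \<in> A \<Longrightarrow> sc c u \<in> A"
    and gens: "a \<in> A" "b \<in> A" "\<And>k. g k \<in> A"
  shows "x k \<in> A \<and> y k \<in> A \<and> G k \<in> A"
proof -
  have xy: "x k \<in> A \<and> y k \<in> A" for k
    by (induction k) (auto simp: qc_def intro!: assms)
  then show ?thesis
    by (auto simp: G_def cm_def intro!: assms)
qed

lemma fam_qalg: "q \<noteq> 0 \<Longrightarrow> qalg fam_scale fam_mult q (inverse q)"
  by unfold_locales simp

section \<open>Translation between relators and locale assumptions\<close>

lemma Oq_rels_closed: "Oq_rels q \<subseteq> carrier free_alg"
  unfolding Oq_rels_def by auto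

lemma Oqv_rels_closed: "Oqv_rels q \<subseteq> carrier free_alg"
  unfolding Oqv_rels_def Let_def by auto

lemma Oq_rels_iff_alternating:
  assumes "free_alg_hom R \<sigma> \<psi>" and q0: "q \<noteq> 0"
  shows "(\<forall>s\<in>Oq_rels q. \<psi> s = \<zero>\<^bsub>R\<^esub>) \<longleftrightarrow>
    alternating fam_scale fam_mult q (inverse q) (rho q)
      (\<lambda>k. fam_embed R \<sigma> (\<psi> (fa_var (OWn k)))) (\<lambda>k. fam_embed R \<sigma> (\<psi> (fa_var (OWp k))))
      (\<lambda>k. fam_embed R \<sigma> (\<psi> (fa_var (OG k)))) (\<lambda>k. fam_embed R \<sigma> (\<psi> (fa_var (OGt k))))"
proof -
  interpret free_alg_hom R \<sigma> \<psi>
    by (fact assms(1))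
  interpret Q: qalg fam_scale fam_mult q "inverse q"
    by (rule fam_qalg[OF q0])
  have qcomm: "emb (fa_qcomm q p s) = Q.qc (emb p) (emb s)" if "p \<in> carrier free_alg" "s \<in> carrier free_alg" for p s
    using that by (simp add: emb_qcomm Q.qc_def)
  have "(\<forall>s\<in>Oq_rels q. \<psi> s = \<zero>\<^bsub>R\<^esub>) \<longleftrightarrow> (\<forall>s\<in>Oq_rels q. emb s = 0)"
    using Oq_rels_closed emb_eq_0_iff by blast
  also have "\<dots> \<longleftrightarrow> alternating fam_scale fam_mult q (inverse q) (rho q)
      (\<lambda>k. emb (fa_var (OWn k))) (\<lambda>k. emb (fa_var (OWp k)))
      (\<lambda>k. emb (fa_var (OG k))) (\<lambda>k. emb (fa_var (OGt k)))"
    unfolding Oq_rels_def alternating_def alternating_axioms_def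
    by (simp add: Q.qalg_axioms emb_sub emb_add emb_smult emb_comm qcomm fam.sc_diff_right all_conj_distrib)
  finally show ?thesis
    by (simp add: emb_def)
qed

lemma rho_nonzero:
  fixes q :: "'f::field"
  assumes q0: "q \<noteq> 0" and root: "\<And>j. j > 0 \<Longrightarrow> q ^ j \<noteq> 1"
  shows "rho q \<noteq> 0"
proof
  assume "rho q = 0"
  then have "q\<^sup>2 = (inverse q)\<^sup>2"
    by (simp add: rho_def)
  then have "q\<^sup>2 * q\<^sup>2 = (inverse q)\<^sup>2 * q\<^sup>2"
    by simp
  also have "\<dots> = 1"
    using q0 by (simp flip: power_mult_distrib)
  finally have "q\<^sup>2 * q\<^sup>2 = 1" .
  then have "q ^ 4 = 1"
    by (simp flip: power_add)
  then show False
    using root[of 4] by simp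
qed

lemma Oqv_rels_iff_compact:
  assumes "free_alg_hom R \<sigma> \<psi>" and q0: "q \<noteq> 0" and root: "\<And>j. j > 0 \<Longrightarrow> q ^ j \<noteq> 1"
  shows "(\<forall>s\<in>Oqv_rels q. \<psi> s = \<zero>\<^bsub>R\<^esub>) \<longleftrightarrow>
    compact fam_scale fam_mult q (inverse q) (rho q)
      (fam_embed R \<sigma> (\<psi> (fa_var VW0))) (fam_embed R \<sigma> (\<psi> (fa_var VW1)))
      (\<lambda>k. fam_embed R \<sigma> (\<psi> (fa_var (VGt k))))"
proof -
  interpret free_alg_hom R \<sigma> \<psi>
    by (fact assms(1))
  interpret Q: qalg fam_scale fam_mult q "inverse q"
    by (rule fam_qalg[OF q0])
  let ?c = "(q\<^sup>2 - (inverse q)\<^sup>2)\<^sup>2"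
  have c: "?c = - rho q"
    by (simp add: rho_def)
  have r0: "rho q \<noteq> 0"
    by (rule rho_nonzero[OF q0 root])
  have neg_r0: "- rho q \<noteq> 0"
    using r0 by simp
  have qcomm: "emb (fa_qcomm q p s) = Q.qc (emb p) (emb s)"
    and qcomm': "emb (fa_qcomm (inverse q) p s) = - Q.qc (emb s) (emb p)"
    if "p \<in> carrier free_alg" "s \<in> carrier free_alg" for p s
    using that by (simp_all add: emb_qcomm Q.qc_def)
  define a b g where abg: "a = emb (fa_var VW0)" "b = emb (fa_var VW1)" "g k = emb (fa_var (VGt k))" for k
  \<comment> \<open>The bracket with parameter \<open>inverse q\<close> is minus the reversed
    q-commutator; this sign cancels the one in \<open>- rho q\<close>.\<close>
  have i: "fam.cm u (- Q.qc v u) = fam_scale (- rho q) (fam.cm w u) \<longleftrightarrow> fam.cm u (Q.qc v u) = fam_scale (rho q) (fam.cm w u)"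
    for u v w
    by (simp add: Q.cm_linear fam.sc_minus_left)
  have v: "fam.cm u w = fam_scale (inverse (- rho q)) z \<longleftrightarrow> fam_scale (rho q) (fam.cm w u) = z" for u w z
    unfolding fam.scaled_eq_iff[OF neg_r0]
    by (simp add: fam.sc_minus_left Q.cm_swap[of u w] fam.sc_minus_right)
  have "(\<forall>s\<in>Oqv_rels q. \<psi> s = \<zero>\<^bsub>R\<^esub>) \<longleftrightarrow> (\<forall>s\<in>Oqv_rels q. emb s = 0)"
    using Oqv_rels_closed emb_eq_0_iff by blast
  also have "\<dots> \<longleftrightarrow>
      (fam.cm a (Q.qc (Q.qc a b) a) = fam_scale (rho q) (fam.cm b a) \<and>
      fam.cm b (Q.qc (Q.qc b a) b) = fam_scale (rho q) (fam.cm a b) \<and>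
      fam.cm a (g 0) = fam.cm a (Q.qc a b) \<and> fam.cm (g 0) b = fam.cm (Q.qc a b) b \<and>
      (\<forall>k. fam_scale (rho q) (fam.cm a (g (Suc k))) = fam.cm a (Q.qc a (Q.qc b (g k)))) \<and>
      (\<forall>k. fam_scale (rho q) (fam.cm (g (Suc k)) b) = fam.cm (Q.qc (Q.qc (g k) a) b) b) \<and>
      (\<forall>k l. fam.cm (g k) (g l) = 0))"
    unfolding Oqv_rels_def Let_def c
    by (simp add: emb_sub emb_smult emb_comm qcomm qcomm' i v ball_Un all_conj_distrib flip: abg del: inverse_minus_eq)
  also have "\<dots> \<longleftrightarrow> compact fam_scale fam_mult q (inverse q) (rho q) a b g"
    unfolding compact_def compact_axioms_def using Q.qalg_axioms root r0 by blast
  moreover have "g = (\<lambda>k. emb (fa_var (VGt k)))"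
    by (simp add: abg fun_eq_iff)
  ultimately show ?thesis
    by (simp add: abg emb_def)
qed

lemma quot_kills:
  assumes "S \<subseteq> carrier free_alg" and "s \<in> S" and I: "I = genideal free_alg S"
  shows "I +>\<^bsub>free_alg\<^esub> s = \<zero>\<^bsub>free_alg Quot I\<^esub>"
proof -
  interpret F: ring free_alg
    by (rule free_alg_ring)
  interpret ideal I free_alg
    unfolding I by (rule F.genideal_ideal[OF assms(1)])
  have "s \<in> I"
    unfolding I using F.genideal_self[OF assms(1)] assms(2) by blast
  then show ?thesis
    by (simp add: FactRing_def a_rcos_const)
qed

lemma free_alg_hom_comp:
  assumes "free_alg_hom R \<sigma> \<psi>" and h: "h \<in> ring_hom R S" and "central_algebra S \<tau>" and scal: "\<And>c. h (\<sigma> c) = \<tau> c"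
  shows "free_alg_hom S \<tau> (\<lambda>p. h (\<psi> p))"
proof -
  interpret free_alg_hom R \<sigma> \<psi>
    by (fact assms(1))
  have "(\<lambda>p. h (\<psi> p)) \<in> ring_hom free_alg S"
    using ring_hom_trans[OF hom h] by (simp add: comp_def)
  then show ?thesis
    using assms(3) by (simp add: free_alg_hom_def free_alg_hom_axioms_def hom_scal scal)
qed

theorem theorem1p1:
  fixes q :: "'f::field"
  assumes "q \<noteq> 0"
    and "\<forall>n::nat. n > 0 \<longrightarrow> q ^ n \<noteq> 1"
  shows "\<exists>h. h \<in> ring_iso (Oqv q) (Oq q)
           \<and> (\<forall>c. h (a_r_coset free_alg (Oqv_ideal q) (fa_scal c))
                  = a_r_coset free_alg (Oq_ideal q) (fa_scal c))
           \<and> h (a_r_coset free_alg (Oqv_ideal q) (fa_var VW0))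
                  = a_r_coset free_alg (Oq_ideal q) (fa_var (OWn 0))
           \<and> h (a_r_coset free_alg (Oqv_ideal q) (fa_var VW1))
                  = a_r_coset free_alg (Oq_ideal q) (fa_var (OWp 0))
           \<and> (\<forall>k. h (a_r_coset free_alg (Oqv_ideal q) (fa_var (VGt k)))
                  = a_r_coset free_alg (Oq_ideal q) (fa_var (OGt k)))"
proof -
  have root: "q ^ j \<noteq> 1" if "j > 0" for j
    using assms(2) that by blast
  have r0: "rho q \<noteq> 0"
    by (rule rho_nonzero[OF assms(1) root])
  interpret F: ring "free_alg :: (ogen list \<Rightarrow> 'f) ring"
    by (rule free_alg_ring)
  interpret Fv: ring "free_alg :: (vgen list \<Rightarrow> 'f) ring"
    by (rule free_alg_ring)
  define \<pi> where "\<pi> = a_r_coset free_alg (Oq_ideal q)"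
  define \<pi>v where "\<pi>v = a_r_coset free_alg (Oqv_ideal q)"
  define \<sigma> where "\<sigma> = quot_scal (Oq_ideal q)"
  define \<sigma>v where "\<sigma>v = quot_scal (Oqv_ideal q)"
  interpret O: free_alg_hom "Oq q" \<sigma> \<pi>
    unfolding Oq_def \<sigma>_def \<pi>_def
    by (rule quot_hom) (simp add: Oq_ideal_def F.genideal_ideal Oq_rels_closed)
  interpret V: free_alg_hom "Oqv q" \<sigma>v \<pi>v
    unfolding Oqv_def \<sigma>v_def \<pi>v_def
    by (rule quot_hom) (simp add: Oqv_ideal_def Fv.genideal_ideal Oqv_rels_closed)
  have rep: "\<exists>p\<in>carrier free_alg. X = \<pi> p" if "X \<in> carrier (Oq q)" for X
    using that by (auto simp: Oq_def \<pi>_def FactRing_def A_RCOSETS_def')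
  have repv: "\<exists>p\<in>carrier free_alg. X = \<pi>v p" if "X \<in> carrier (Oqv q)" for X
    using that by (auto simp: Oqv_def \<pi>v_def FactRing_def A_RCOSETS_def')
  have kill: "\<pi> s = \<zero>\<^bsub>Oq q\<^esub>" if "s \<in> Oq_rels q" for s
    unfolding Oq_def \<pi>_def by (rule quot_kills[OF Oq_rels_closed that Oq_ideal_def])
  have killv: "\<pi>v s = \<zero>\<^bsub>Oqv q\<^esub>" if "s \<in> Oqv_rels q" for s
    unfolding Oqv_def \<pi>v_def by (rule quot_kills[OF Oqv_rels_closed that Oqv_ideal_def])

  have alt: "alternating fam_scale fam_mult q (inverse q) (rho q)
      (\<lambda>k. O.embed (\<pi> (fa_var (OWn k)))) (\<lambda>k. O.embed (\<pi> (fa_var (OWp k))))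
      (\<lambda>k. O.embed (\<pi> (fa_var (OG k)))) (\<lambda>k. O.embed (\<pi> (fa_var (OGt k))))"
    using Oq_rels_iff_alternating[OF O.free_alg_hom_axioms assms(1)] kill by simp
  interpret C: compact fam_scale fam_mult q "inverse q" "rho q"
      "V.embed (\<pi>v (fa_var VW0))" "V.embed (\<pi>v (fa_var VW1))" "\<lambda>k. V.embed (\<pi>v (fa_var (VGt k)))"
    using Oqv_rels_iff_compact[OF V.free_alg_hom_axioms assms(1) root] killv by simp
  have nz: "q + inverse q \<noteq> 0"
    by (rule level.qp_sum_nz[OF C.level_all])

  \<comment> \<open>The map \<open>h\<close> exists because the images of the generators satisfy the
    compact relations in \<open>Oq q\<close>.\<close>
  have "\<exists>h\<in>ring_hom (Oqv q) (Oq q). (\<forall>c. h (\<pi>v (fa_scal c)) = \<pi> (fa_scal c)) \<and>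
    h (\<pi>v (fa_var VW0)) = \<pi> (fa_var (OWn 0)) \<and> h (\<pi>v (fa_var VW1)) = \<pi> (fa_var (OWp 0)) \<and>
    (\<forall>k. h (\<pi>v (fa_var (VGt k))) = \<pi> (fa_var (OGt k)))"
  proof -
    define v where "v x = \<pi> (fa_var (case x of VW0 \<Rightarrow> OWn 0 | VW1 \<Rightarrow> OWp 0 | VGt k \<Rightarrow> OGt k))" for x
    obtain \<psi> where \<psi>: "free_alg_hom (Oq q) \<sigma> \<psi>" "\<And>x. \<psi> (fa_var x) = v x"
      using O.free_alg_hom_exists[of v] by (auto simp: v_def)
    have "compact fam_scale fam_mult q (inverse q) (rho q) (O.embed (\<psi> (fa_var VW0))) (O.embed (\<psi> (fa_var VW1)))
        (\<lambda>k. O.embed (\<psi> (fa_var (VGt k))))"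
      using alternating.compact[OF alt root r0 nz] by (simp add: \<psi> v_def)
    then have kill_\<psi>: "\<psi> s = \<zero>\<^bsub>Oq q\<^esub>" if "s \<in> Oqv_rels q" for s
      using Oqv_rels_iff_compact[OF \<psi>(1) assms(1) root] that by blast
    obtain h where h: "h \<in> ring_hom (Oqv q) (Oq q)" "\<And>p. p \<in> carrier free_alg \<Longrightarrow> h (\<pi>v p) = \<psi> p"
      using quot_lift[OF \<psi>(1) Oqv_rels_closed[of q] kill_\<psi> Oqv_ideal_def] by (auto simp: \<pi>v_def Oqv_def)
    then show ?thesis
      by (intro bexI[of _ h]) (simp_all add: \<psi> v_def free_alg_hom.hom_scal[OF \<psi>(1)] O.hom_scal)
  qed
  then obtain h where h: "h \<in> ring_hom (Oqv q) (Oq q)" "\<And>c. h (\<pi>v (fa_scal c)) = \<pi> (fa_scal c)"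
      "h (\<pi>v (fa_var VW0)) = \<pi> (fa_var (OWn 0))" "h (\<pi>v (fa_var VW1)) = \<pi> (fa_var (OWp 0))"
      "\<And>k. h (\<pi>v (fa_var (VGt k))) = \<pi> (fa_var (OGt k))"
    by blast

  \<comment> \<open>For the reverse map the generators go to the elements built in \<open>C\<close>,
    pulled back to \<open>Oqv q\<close>; they satisfy the alternating relations.\<close>
  have "\<exists>h'\<in>ring_hom (Oq q) (Oqv q). (\<forall>c. h' (\<pi> (fa_scal c)) = \<pi>v (fa_scal c)) \<and>
    h' (\<pi> (fa_var (OWn 0))) = \<pi>v (fa_var VW0) \<and> h' (\<pi> (fa_var (OWp 0))) = \<pi>v (fa_var VW1) \<and>
    (\<forall>k. h' (\<pi> (fa_var (OGt k))) = \<pi>v (fa_var (VGt k)))"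
  proof -
    have gens: "V.embed (\<pi>v (fa_var x)) \<in> V.embed_range" for x
      by (simp add: V.embed_range_def)
    have "C.x k \<in> V.embed_range \<and> C.y k \<in> V.embed_range \<and> C.G k \<in> V.embed_range" for k
      by (rule C.xy_closed) (auto intro: V.embed_range_closed gens)
    then have "\<exists>u\<in>carrier (Oqv q).
        (case z of OWn k \<Rightarrow> C.x k | OWp k \<Rightarrow> C.y k | OG k \<Rightarrow> C.G k | OGt k \<Rightarrow> V.embed (\<pi>v (fa_var (VGt k)))) = V.embed u" for z
      using gens by (cases z) (auto simp: V.embed_range_def image_iff)
    then obtain v where v: "\<And>z. v z \<in> carrier (Oqv q)" "\<And>z. V.embed (v z) =
        (case z of OWn k \<Rightarrow> C.x k | OWp k \<Rightarrow> C.y k | OG k \<Rightarrow> C.G k | OGt k \<Rightarrow> V.embed (\<pi>v (fa_var (VGt k))))"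
      by metis
    obtain \<psi> where \<psi>: "free_alg_hom (Oqv q) \<sigma>v \<psi>" "\<And>x. \<psi> (fa_var x) = v x"
      using V.free_alg_hom_exists[of v] v(1) by blast
    have "alternating fam_scale fam_mult q (inverse q) (rho q)
      (\<lambda>k. V.embed (\<psi> (fa_var (OWn k)))) (\<lambda>k. V.embed (\<psi> (fa_var (OWp k))))
      (\<lambda>k. V.embed (\<psi> (fa_var (OG k)))) (\<lambda>k. V.embed (\<psi> (fa_var (OGt k))))"
      using C.alternating by (simp add: \<psi> v)
    then have kill_\<psi>: "\<psi> s = \<zero>\<^bsub>Oqv q\<^esub>" if "s \<in> Oq_rels q" for s
      using Oq_rels_iff_alternating[OF \<psi>(1) assms(1)] that by blast
    obtain h' where h': "h' \<in> ring_hom (Oq q) (Oqv q)" "\<And>p. p \<in> carrier free_alg \<Longrightarrow> h' (\<pi> p) = \<psi> p"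
      using quot_lift[OF \<psi>(1) Oq_rels_closed[of q] kill_\<psi> Oq_ideal_def] by (auto simp: \<pi>_def Oq_def)
    have v0: "v (OWn 0) = \<pi>v (fa_var VW0)" "v (OWp 0) = \<pi>v (fa_var VW1)" "v (OGt k) = \<pi>v (fa_var (VGt k))" for k
      by (rule inj_onD[OF V.embed_inj]; simp add: v)+
    show ?thesis
      by (rule bexI[OF _ h'(1)]) (simp add: h'(2) \<psi> v0 free_alg_hom.hom_scal[OF \<psi>(1)] V.hom_scal)
  qed
  then obtain h' where h': "h' \<in> ring_hom (Oq q) (Oqv q)" "\<And>c. h' (\<pi> (fa_scal c)) = \<pi>v (fa_scal c)"
      "h' (\<pi> (fa_var (OWn 0))) = \<pi>v (fa_var VW0)" "h' (\<pi> (fa_var (OWp 0))) = \<pi>v (fa_var VW1)"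
      "\<And>k. h' (\<pi> (fa_var (OGt k))) = \<pi>v (fa_var (VGt k))"
    by blast

  have hv: "free_alg_hom (Oq q) \<sigma> (\<lambda>p. h (\<pi>v p))"
    using free_alg_hom_comp[OF V.free_alg_hom_axioms h(1) O.central_algebra_axioms] h(2)
    by (simp add: V.hom_scal O.hom_scal)
  have h'o: "free_alg_hom (Oqv q) \<sigma>v (\<lambda>p. h' (\<pi> p))"
    using free_alg_hom_comp[OF O.free_alg_hom_axioms h'(1) V.central_algebra_axioms] h'(2)
    by (simp add: V.hom_scal O.hom_scal)
  \<comment> \<open>This composite visibly fixes every generator of \<open>Oqv q\<close>.\<close>
  have h'h: "h' (h X) = X" if "X \<in> carrier (Oqv q)" for X
  proof -
    have "free_alg_hom (Oqv q) \<sigma>v (\<lambda>p. h' (h (\<pi>v p)))"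
      using free_alg_hom_comp[OF hv h'(1) V.central_algebra_axioms] h'(2) by (simp add: V.hom_scal O.hom_scal)
    moreover have "h' (h (\<pi>v (fa_var x))) = \<pi>v (fa_var x)" for x
      by (cases x) (simp_all add: h h')
    ultimately have "h' (h (\<pi>v p)) = \<pi>v p" if "p \<in> carrier free_alg" for p
      using that by (rule V.hom_eqI)
    then show ?thesis
      using repv[OF that] by blast
  qed
  have hh': "h (h' Y) = Y" if "Y \<in> carrier (Oq q)" for Y
  proof -
    have hom: "free_alg_hom (Oq q) \<sigma> (\<lambda>p. h (h' (\<pi> p)))"
      using free_alg_hom_comp[OF h'o h(1) O.central_algebra_axioms] h(2) by (simp add: V.hom_scal O.hom_scal)
    have "h (h' (\<pi> s)) = \<zero>\<^bsub>Oq q\<^esub>" if "s \<in> Oq_rels q" for s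
      unfolding kill[OF that]
      using ring_hom_zero[OF h'(1) O.ring_axioms V.ring_axioms] ring_hom_zero[OF h(1) V.ring_axioms O.ring_axioms] by simp
    \<comment> \<open>The other composite is only known to fix \<open>OWn 0\<close>,
      \<open>OWp 0\<close> and all \<open>OGt k\<close>. As the images of the remaining generators
      satisfy the same relations, uniqueness forces them to be fixed too.\<close>
    then have "alternating fam_scale fam_mult q (inverse q) (rho q)
      (\<lambda>k. O.embed (h (h' (\<pi> (fa_var (OWn k)))))) (\<lambda>k. O.embed (h (h' (\<pi> (fa_var (OWp k))))))
      (\<lambda>k. O.embed (h (h' (\<pi> (fa_var (OG k)))))) (\<lambda>k. O.embed (\<pi> (fa_var (OGt k))))"
      using Oq_rels_iff_alternating[OF hom assms(1)] by (simp add: h h')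
    note unique = alternating_unique[OF this alt _ _ r0 nz]
    have closed: "h (h' (\<pi> (fa_var x))) \<in> carrier (Oq q)" for x
      using free_alg_hom.hom_closed[OF hom] by simp
    have "h (h' (\<pi> (fa_var x))) = \<pi> (fa_var x)" for x
      by (rule inj_onD[OF O.embed_inj _ closed]) (cases x; use unique in \<open>simp add: h h'\<close>)+
    then have "h (h' (\<pi> p)) = \<pi> p" if "p \<in> carrier free_alg" for p
      using that by (rule O.hom_eqI[OF hom])
    then show ?thesis
      using rep[OF that] by blast
  qed
  have "bij_betw h (carrier (Oqv q)) (carrier (Oq q))"
    by (rule bij_betw_byWitness[of _ h']) (use h'h hh' ring_hom_closed[OF h(1)] ring_hom_closed[OF h'(1)] in auto)
  then have "h \<in> ring_iso (Oqv q) (Oq q)"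
    using h(1) by (simp add: ring_iso_def)
  then show ?thesis
    using h unfolding \<pi>_def \<pi>v_def by blast
qed

end
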